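(* Let $d\in\mathbb{N}$ and let $g:\mathbb{R}^d\to\mathbb{R}$ be the random linear map $g(x)=\gamma^\top x$, where $\gamma\in\mathbb{R}^d$ has i.i.d. $\mathcal{N}(0,\pi/2)$ entries. Then for every finite set $P\subset\mathbb{R}^d$ of even size with $\operatorname{opt}_{\mathrm{max\text{-}match}}(P)>0$, $$1\le\frac{\mathbf{E}[\operatorname{opt}_{\mathrm{max\text{-}match}}(g(P))]}{\operatorname{opt}_{\mathrm{max\text{-}match}}(P)}\le\sqrt2.$$ Moreover, there is a universal constant $C>0$ such that for every $\varepsilon\in(0,1)$ and a Gaussian JL map $G\in\mathbb{R}^{t\times d}$ with $t=\lceil C\varepsilon^{-2}\rceil$, for every such $P$, with probability at least $2/3$, $\operatorname{opt}_{\mathrm{max\text{-}match}}(G(P))$ is a $(\sqrt2+\varepsilon)$-approximation of $\operatorname{opt}_{\mathrm{max\text{-}match}}(P)$, namely $\operatorname{opt}_{\mathrm{max\text{-}match}}(P)/(1+\varepsilon)\le\operatorname{opt}_{\mathrm{max\text{-}match}}(G(P))\le(\sqrt2+\varepsilon)\operatorname{opt}_{\mathrm{max\text{-}match}}(P)$.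
   Context: Norms are Euclidean (absolute value in $\mathbb{R}$). A Gaussian JL map is a random $t\times d$ matrix with i.i.d. $\mathcal{N}(0,1/t)$ entries; for a map $h$, $h(P)=\{h(p):p\in P\}$. For a finite point set $Q$, $\operatorname{opt}_{\mathrm{max\text{-}match}}(Q)$ is the maximum of $\sum_{\{p,q\}\in M}\|p-q\|$ over all matchings $M$ of the complete graph on $Q$. *)

theory Defs
  imports "HOL-Probability.Probability"
begin

text \<open>Points of R^d are represented as extensional functions as extensional functions on the index set 0..d-1.\<close>

definition eucl_norm :: "nat \<Rightarrow> (nat \<Rightarrow> real) \<Rightarrow> real" where
  "eucl_norm d x = sqrt (\<Sum>i<d. (x i)\<^sup>2)"

definition eucl_dist :: "nat \<Rightarrow> (nat \<Rightarrow> real) \<Rightarrow> (nat \<Rightarrow> real) \<Rightarrow> real" where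
  "eucl_dist d x y = eucl_norm d (\<lambda>i. x i - y i)"

text \<open>A matching of the complete graph on Q, each edge {p,q} recorded once as an ordered pair.\<close>
definition is_matching :: "'a set \<Rightarrow> ('a \<times> 'a) set \<Rightarrow> bool" where
  "is_matching Q M \<longleftrightarrow> M \<subseteq> Q \<times> Q \<and> (\<forall>(p,q)\<in>M. p \<noteq> q)
     \<and> card (fst ` M \<union> snd ` M) = 2 * card M"

definition opt_max_match :: "('a \<Rightarrow> 'a \<Rightarrow> real) \<Rightarrow> 'a set \<Rightarrow> real" where
  "opt_max_match \<delta> Q = Max {(\<Sum>(p,q)\<in>M. \<delta> p q) | M. is_matching Q M}"

definition gamma_space :: "nat \<Rightarrow> (nat \<Rightarrow> real) measure" where
  "gamma_space d = PiM {..<d} (\<lambda>_. density lborel (normal_density 0 (sqrt (pi / 2))))"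

definition lin_form :: "nat \<Rightarrow> (nat \<Rightarrow> real) \<Rightarrow> (nat \<Rightarrow> real) \<Rightarrow> real" where
  "lin_form d \<gamma> x = (\<Sum>j<d. \<gamma> j * x j)"

definition gaussian_JL :: "nat \<Rightarrow> nat \<Rightarrow> (nat \<times> nat \<Rightarrow> real) measure" where
  "gaussian_JL t d = PiM ({..<t} \<times> {..<d}) (\<lambda>_. density lborel (normal_density 0 (sqrt (1 / real t))))"

definition apply_matrix :: "nat \<Rightarrow> nat \<Rightarrow> (nat \<times> nat \<Rightarrow> real) \<Rightarrow> (nat \<Rightarrow> real) \<Rightarrow> (nat \<Rightarrow> real)" where
  "apply_matrix t d G x = (\<lambda>i\<in>{..<t}. \<Sum>j<d. G (i, j) * x j)"

end

theory Submission
  imports Defs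
begin

text \<open>
  The point is that \<open>P\<close> has a perfect matching whose diametral balls share a point \<open>z\<close>. Then
  \<open>|p - z| + |q - z| \<le> \<surd>2 |p - q|\<close> for every matched pair, so the star from \<open>z\<close> has total length at most
  \<open>\<surd>2 opt P\<close>. By the triangle inequality the star from \<open>g z\<close> bounds the optimum of \<open>g ` P\<close> for every
  \<open>g\<close>, while the image of an optimal matching bounds it from below when \<open>g\<close> is injective on \<open>P\<close>. Both
  bounds are sums of lengths of fixed vectors, so it suffices to control a random map on one vector: the
  Gaussian form preserves lengths in expectation, and the JL map distorts \<open>|v|\<close> by at most
  \<open>\<surd>(2/t) |v|\<close> in expectation, after which Markov's inequality applies.

  To find \<open>z\<close>, minimise the sum of the squared positive parts of \<open>\<langle>p - z, m p - z\<rangle>\<close> over perfect matchings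
  \<open>m\<close> and points \<open>z\<close>. If the minimum is positive, stationarity in \<open>z\<close> makes the relation
  \<open>\<langle>p - z, q - z\<rangle> \<le> 0\<close> connected on the set of points with a positive term. A perfect matching disjoint
  from a connected spanning graph is never the only perfect matching of the union (Kotzig), and any other
  one lowers the sum.
\<close>

section \<open>A connected graph together with a perfect matching\<close>

text \<open>It records only that a set splits into disjoint \<open>E\<close>-edges, not which ones,
  so that partial matchings found on a path, a cycle and their complement glue by unions. The
  relation \<open>E\<close> is not assumed symmetric; each edge enters in one orientation.\<close>

inductive matchable :: "('a \<Rightarrow> 'a \<Rightarrow> bool) \<Rightarrow> 'a set \<Rightarrow> bool" for E where
  empty: "matchable E {}"
| insert: "\<lbrakk>matchable E S; a \<notin> S; b \<notin> S; a \<noteq> b; E a b\<rbrakk> \<Longrightarrow> matchable E (insert a (insert b S))"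

lemma matchable_insert_pair:
  assumes "matchable E T" "E a b" "a \<noteq> b" "a \<notin> T" "b \<notin> T" "S = insert a (insert b T)"
  shows "matchable E S"
  using matchable.insert assms by metis

lemma matchable_union:
  assumes "matchable E S" "matchable E T" "S \<inter> T = {}"
  shows "matchable E (S \<union> T)"
  using assms
proof induction
  case (insert S a b)
  then show ?case by - (rule matchable_insert_pair[of E "S \<union> T" a b], auto)
qed simp

text \<open>A perfect matching encoded by its partner function. Only the values on \<open>S\<close>
  matter, so one \<open>m\<close> serves every subset that is closed under it.\<close>

definition fpf_involution_on :: "'a set \<Rightarrow> ('a \<Rightarrow> 'a) \<Rightarrow> bool" where
  "fpf_involution_on S m \<longleftrightarrow> (\<forall>p\<in>S. m p \<in> S \<and> m p \<noteq> p \<and> m (m p) = p)"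

lemma fpf_involution_on_cases:
  assumes "fpf_involution_on S m" "finite S" "S \<noteq> {}"
  obtains a T where "a \<in> S" "S = insert a (insert (m a) T)" "a \<noteq> m a" "a \<notin> T" "m a \<notin> T"
    "fpf_involution_on T m" "card T < card S" "T \<subseteq> S" "T = S - {a, m a}"
proof -
  obtain a where a: "a \<in> S" using assms by auto
  have "m a \<in> S" "a \<noteq> m a" using a assms unfolding fpf_involution_on_def by metis+
  moreover have "fpf_involution_on (S - {a, m a}) m"
    using assms(1) a unfolding fpf_involution_on_def
    by (metis DiffD1 DiffD2 DiffI empty_iff insert_iff)
  moreover have "card (S - {a, m a}) < card S"
    using a assms(2) by (intro psubset_card_mono) auto
  ultimately show ?thesis using a by (intro that[of a "S - {a, m a}"]) auto
qed

lemma matchable_fpf_involution: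
  assumes "fpf_involution_on S m" "finite S" "\<And>a. a \<in> S \<Longrightarrow> E a (m a)"
  shows "matchable E S"
  using assms
proof (induction "card S" arbitrary: S rule: less_induct)
  case less
  show ?case
  proof (cases "S = {}")
    case True then show ?thesis by (simp add: matchable.empty)
  next
    case False
    obtain a T where aT: "a \<in> S" "S = insert a (insert (m a) T)" "a \<noteq> m a" "a \<notin> T" "m a \<notin> T"
      "fpf_involution_on T m" "card T < card S" "T \<subseteq> S"
      using fpf_involution_on_cases[OF less.prems(1,2) False] by metis
    have "matchable E T" using less.hyps[OF aT(7) aT(6)] less.prems aT(8) finite_subset by blast
    then show ?thesis using aT less.prems by - (rule matchable_insert_pair[of E T a "m a"], auto)
  qed
qed

text \<open>Each edge is known in one orientation only, while the partner function sees it from both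
  ends; hence the disjunction.\<close>

lemma matchable_imp_fpf_involution:
  assumes "matchable E S"
  obtains n where "fpf_involution_on S n" "\<And>p. p \<in> S \<Longrightarrow> E p (n p) \<or> E (n p) p"
proof -
  have "\<exists>n. fpf_involution_on S n \<and> (\<forall>p\<in>S. E p (n p) \<or> E (n p) p)" using assms
  proof induction
    case empty then show ?case by (auto simp: fpf_involution_on_def)
  next
    case (insert S a b)
    then obtain n where n: "fpf_involution_on S n" "\<forall>p\<in>S. E p (n p) \<or> E (n p) p" by auto
    have "fpf_involution_on (insert a (insert b S)) (n(a := b, b := a))"
      using insert n(1) unfolding fpf_involution_on_def by auto
    moreover have "\<forall>p\<in>insert a (insert b S). E p ((n(a := b, b := a)) p) \<or> E ((n(a := b, b := a)) p) p"
      using insert n by auto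
    ultimately show ?case by blast
  qed
  then show ?thesis using that by blast
qed

lemma matchable_even_card:
  assumes "finite S" "even (card S)" shows "matchable (\<lambda>_ _. True) S"
  using assms
proof (induction "card S" arbitrary: S rule: less_induct)
  case less
  show ?case
  proof (cases "S = {}")
    case True then show ?thesis by (simp add: matchable.empty)
  next
    case False
    then obtain a where a: "a \<in> S" by auto
    have "S - {a} \<noteq> {}"
    proof
      assume "S - {a} = {}"
      then have "S = {a}" using a by auto
      then show False using less.prems by simp
    qed
    then obtain b where b: "b \<in> S" "b \<noteq> a" by auto
    have c: "card (S - {a,b}) = card S - 2" using a b less.prems
      by (subst card_Diff_subset) auto
    have "card S > 0" using a less.prems by (auto simp: card_gt_0_iff)
    then have "matchable (\<lambda>_ _. True) (S - {a,b})"
      using less.hyps[of "S - {a,b}"] less.prems c by auto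
    then show ?thesis by (rule matchable_insert_pair[where a=a and b=b]) (use a b in auto)
  qed
qed

text \<open>Red edges are those of \<open>R\<close>, blue edges are \<open>p, m p\<close>. The path starts at \<open>a\<close> with a blue edge;
  \<open>A\<close> holds the first endpoint of each of its blue edges, \<open>h\<close> that of the last one.\<close>
inductive alternating_path :: "'a set \<Rightarrow> ('a \<Rightarrow> 'a) \<Rightarrow> ('a \<Rightarrow> 'a \<Rightarrow> bool) \<Rightarrow> 'a \<Rightarrow> 'a set \<Rightarrow> 'a \<Rightarrow> bool"
  for V m R a where
  start: "a \<in> V \<Longrightarrow> alternating_path V m R a {a} a"
| extend: "\<lbrakk>alternating_path V m R a A h; R (m h) c; c \<in> V; c \<notin> A \<union> m ` A\<rbrakk>
     \<Longrightarrow> alternating_path V m R a (insert c A) c"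

lemma alternating_path_subset:
  assumes "alternating_path V m R a A h"
  shows "A \<subseteq> V" "finite A" "a \<in> A" "h \<in> A"
  using assms by induction auto

text \<open>Cutting off the part before \<open>x\<close> keeps the freshness condition of every
  later step, which then refers to a smaller set. This isolates the cycle closed by a red edge that
  returns to the path.\<close>

lemma alternating_path_suffix:
  assumes "alternating_path V m R a A h" "x \<in> A"
  shows "\<exists>A'\<subseteq>A. alternating_path V m R x A' h"
  using assms
proof induction
  case start then show ?case using alternating_path.start[of x V m R] by auto
next
  case (extend A h c)
  show ?case
  proof (cases "x = c")
    case True then show ?thesis using extend alternating_path.start[of c V m R] by auto
  next
    case False
    then obtain A' where "A' \<subseteq> A" "alternating_path V m R x A' h" using extend by auto
    then have "alternating_path V m R x (insert c A') c"
      using extend by (intro alternating_path.extend) auto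
    then show ?thesis using \<open>A' \<subseteq> A\<close>
      by (intro exI[of _ "insert c A'"] conjI) auto
  qed
qed

section \<open>Matchings that remain on an alternating path after deleting vertices\<close>

abbreviation red_or_blue where "red_or_blue m R \<equiv> \<lambda>p q. R p q \<or> q = m p"

text \<open>The visited set is closed under \<open>m\<close>, so a fresh vertex brings a fresh
  partner.\<close>

lemma involution_image_disjoint:
  assumes "fpf_involution_on V m" "A \<subseteq> V" "c \<in> V" "c \<notin> A \<union> m ` A"
  shows "m c \<notin> insert c (A \<union> m ` A)"
proof -
  have 1: "m c \<noteq> c" "m (m c) = c" using assms unfolding fpf_involution_on_def by auto
  have "m c \<notin> A" using 1 assms(4) by (metis UnCI image_eqI)
  moreover have "m c \<notin> m ` A"
  proof
    assume "m c \<in> m ` A"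
    then obtain b where "b \<in> A" "m c = m b" by auto
    then have "c = b" using 1 assms unfolding fpf_involution_on_def by (metis subsetD)
    then show False using assms \<open>b \<in> A\<close> by auto
  qed
  ultimately show ?thesis using 1 by auto
qed

lemma alternating_path_disjoint:
  assumes "alternating_path V m R a A h" "fpf_involution_on V m"
  shows "A \<inter> m ` A = {}"
  using assms
proof induction
  case start then show ?case unfolding fpf_involution_on_def by auto
next
  case (extend A h c)
  have "m c \<notin> insert c (A \<union> m ` A)"
    using involution_image_disjoint[OF extend.prems alternating_path_subset(1)[OF extend(1)] extend(3,4)] .
  then show ?case using extend by auto
qed

lemma involution_on_closure:
  assumes m: "fpf_involution_on V m" and A: "A \<subseteq> V"
  shows "fpf_involution_on (A \<union> m ` A) m" "A \<union> m ` A \<subseteq> V"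
proof -
  have V: "m p \<in> V" "m p \<noteq> p" "m (m p) = p" if "p \<in> V" for p
    using m that unfolding fpf_involution_on_def by auto
  then show "A \<union> m ` A \<subseteq> V" using A by auto
  show "fpf_involution_on (A \<union> m ` A) m"
    unfolding fpf_involution_on_def
  proof
    fix p assume "p \<in> A \<union> m ` A"
    then consider "p \<in> A" | q where "q \<in> A" "p = m q" by auto
    then show "m p \<in> A \<union> m ` A \<and> m p \<noteq> p \<and> m (m p) = p"
    proof cases
      case 1 then show ?thesis using V[of p] A by auto
    next
      case 2 then show ?thesis using V[of q] V[of p] A by auto
    qed
  qed
qed

lemma fpf_involution_on_inj: "fpf_involution_on V m \<Longrightarrow> inj_on m V"
  unfolding fpf_involution_on_def inj_on_def by metis

lemma fpf_involution_on_Diff: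
  assumes "fpf_involution_on V m" "fpf_involution_on A m" "A \<subseteq> V"
  shows "fpf_involution_on (V - A) m"
  using assms unfolding fpf_involution_on_def by (metis Diff_iff subsetD)

text \<open>Each red edge joins the far end of a blue edge to the first endpoint of the next one, so
  the red edges miss only the two ends of the path. In the induction the former end
  \<open>m h\<close> gets matched to the new vertex \<open>c\<close>.\<close>

lemma alternating_path_interior:
  assumes "alternating_path V m R a A h" "fpf_involution_on V m"
  shows "matchable (red_or_blue m R) ((A \<union> m ` A) - {a, m h})"
  using assms
proof induction
  case start then show ?case by (simp add: matchable.empty)
next
  case (extend A h c)
  note D = involution_image_disjoint[OF extend.prems alternating_path_subset(1)[OF extend(1)] extend(3,4)]
  note s = alternating_path_subset[OF extend(1)]
  have dj: "A \<inter> m ` A = {}" using alternating_path_disjoint extend by metis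
  have i: "m h \<noteq> m c"
    using fpf_involution_on_inj[OF extend.prems] s extend.hyps by (metis UnCI inj_onD subsetD)
  have "m h \<in> m ` A" using s by auto
  then have "m h \<noteq> a" "m h \<noteq> c" "a \<noteq> c" using s dj extend.hyps D by auto
  note x = this i
  define B where "B = A \<union> m ` A"
  have B: "insert c A \<union> m ` insert c A = insert c (insert (m c) B)" "m h \<in> B" "c \<notin> B" "m c \<notin> B" "m c \<noteq> c"
    unfolding B_def using s extend.hyps D by auto
  have "m c \<noteq> a" using B s unfolding B_def by auto
  then have "insert c (insert (m c) B) - {a, m c} = insert (m h) (insert c (B - {a, m h}))"
    using B(2-5) x by auto
  moreover have "red_or_blue m R (m h) c" using extend.hyps by simp
  ultimately show ?case unfolding B(1) using B(3) x
    by - (rule matchable_insert_pair[OF extend.IH[OF extend.prems, folded B_def], of "m h" c], auto)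
qed

text \<open>Take the red edges of the path up to \<open>m v\<close> and the blue edges after
  it.\<close>

lemma alternating_path_minus_even:
  assumes "alternating_path V m R a A h" "fpf_involution_on V m" "v \<in> A"
  shows "matchable (red_or_blue m R) ((A \<union> m ` A) - {a, m v})"
  using assms
proof (induction arbitrary: v)
  case start then show ?case by (simp add: matchable.empty)
next
  case (extend A h c)
  note D = involution_image_disjoint[OF extend.prems(1) alternating_path_subset(1)[OF extend(1)] extend(3,4)]
  note s = alternating_path_subset[OF extend(1)]
  show ?case
  proof (cases "v = c")
    case True
    then show ?thesis
      using alternating_path_interior[OF alternating_path.extend[OF extend(1-4)] extend.prems(1)] by simp
  next
    case False
    then have v: "v \<in> A" using extend by auto
    define B where "B = A \<union> m ` A"
    have B: "insert c A \<union> m ` insert c A = insert c (insert (m c) B)" "c \<notin> B" "m c \<notin> B" "m c \<noteq> c"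
      unfolding B_def using s extend.hyps D by auto
    have "m v \<noteq> m c"
      using fpf_involution_on_inj[OF extend.prems(1)] s v extend.hyps by (metis UnCI inj_onD subsetD)
    moreover have "m v \<noteq> c" "a \<noteq> c" "a \<noteq> m c" using v s extend.hyps D by auto
    ultimately show ?thesis unfolding B(1) using B(2-4)
      by - (rule matchable_insert_pair[OF extend.IH[OF extend.prems(1) v, folded B_def], of c "m c"], auto)
  qed
qed

lemma alternating_path_closed_trivial:
  assumes "alternating_path V m R a A a" shows "A = {a}"
  using assms
proof cases
  case (extend B h)
  then show ?thesis using alternating_path_subset(3) by fastforce
qed simp

text \<open>Take the blue edges strictly between the first one and \<open>v\<close>, and the red
  edges after \<open>v\<close>. The vertices \<open>m a\<close> and \<open>m h\<close> are left over
  as well; in a blossom they are joined by the red edge that closes the odd cycle.\<close>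

lemma alternating_path_minus_odd:
  assumes "alternating_path V m R a A h" "fpf_involution_on V m" "v \<in> A" "v \<noteq> a"
  shows "matchable (red_or_blue m R) ((A \<union> m ` A) - {a, m a, v, m h})"
  using assms
proof (induction arbitrary: v)
  case start then show ?case by simp
next
  case (extend A h c)
  note D = involution_image_disjoint[OF extend.prems(1) alternating_path_subset(1)[OF extend(1)] extend(3,4)]
  note s = alternating_path_subset[OF extend(1)]
  have dj: "A \<inter> m ` A = {}" using alternating_path_disjoint extend by metis
  have i: "inj_on m V" using fpf_involution_on_inj extend.prems(1) by metis
  have mm: "m h \<noteq> m a" if "h \<noteq> a" using i s that by (meson inj_onD subsetD)
  show ?case
  proof (cases "v = c")
    case True
    have "fpf_involution_on {a, m a} m" "{a, m a} \<subseteq> A \<union> m ` A"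
      using s extend.prems(1) unfolding fpf_involution_on_def by auto
    then have "fpf_involution_on (A \<union> m ` A - {a, m a}) m"
      using involution_on_closure[OF extend.prems(1) s(1)] fpf_involution_on_Diff by metis
    then have "matchable (red_or_blue m R) (A \<union> m ` A - {a, m a})"
      using s(2) by (intro matchable_fpf_involution) auto
    moreover have "(insert c A \<union> m ` insert c A) - {a, m a, c, m c} = A \<union> m ` A - {a, m a}"
      using extend.hyps D by auto
    ultimately show ?thesis using True by simp
  next
    case False
    then have v: "v \<in> A" using extend by auto
    have IH: "matchable (red_or_blue m R) ((A \<union> m ` A) - {a, m a, v, m h})"
      using extend.IH[OF extend.prems(1) v extend.prems(3)] .
    have i2: "m h \<noteq> m c" "m a \<noteq> m c" using i s extend.hyps by (metis UnCI inj_onD subsetD)+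
    have x: "m h \<noteq> a" "m h \<noteq> c" "m h \<noteq> v" "a \<noteq> c" "m a \<noteq> c" "v \<noteq> m c"
      "c \<noteq> m c" "m a \<noteq> v" "m c \<noteq> a"
      using v s extend.hyps D dj by auto
    have "h \<noteq> a" using alternating_path_closed_trivial extend(1) v extend.prems(3) by fastforce
    then have mha: "m h \<noteq> m a" using mm by auto
    define B where "B = A \<union> m ` A"
    have B: "insert c A \<union> m ` insert c A = insert c (insert (m c) B)" "m h \<in> B" "c \<notin> B" "m c \<notin> B"
      unfolding B_def using s extend.hyps D by auto
    have "insert c (insert (m c) B) - {a, m a, v, m c} = insert (m h) (insert c (B - {a, m a, v, m h}))"
      using B(2-4) x i2 mha \<open>v \<noteq> c\<close> by auto
    moreover have "red_or_blue m R (m h) c" using extend.hyps by simp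
    ultimately show ?thesis unfolding B(1) using B(3) x
      by - (rule matchable_insert_pair[OF IH[folded B_def], of "m h" c], auto)
  qed
qed

lemma alternating_path_maximal:
  assumes "finite V" "V \<noteq> {}"
  obtains a A h where "alternating_path V m R a A h"
    "\<And>c. \<lbrakk>c \<in> V; R (m h) c\<rbrakk> \<Longrightarrow> c \<in> A \<union> m ` A"
proof -
  let ?P = "\<lambda>A. \<exists>a h. alternating_path V m R a A h"
  obtain v where "v \<in> V" using assms by auto
  then have v: "?P {v}" using alternating_path.start by metis
  have "card A < Suc (card V)" if "?P A" for A
    using alternating_path_subset(1) card_mono[OF assms(1)] that less_Suc_eq_le by metis
  then have "\<exists>A. ?P A \<and> (\<forall>B. ?P B \<longrightarrow> card B \<le> card A)"
    using v by (intro ex_has_greatest_nat[of ?P "{v}" card "Suc (card V)"]) auto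
  then obtain A where "?P A" and A: "\<And>B. ?P B \<Longrightarrow> card B \<le> card A" by blast
  then obtain a h where P: "alternating_path V m R a A h" by auto
  show ?thesis
  proof (rule that[OF P])
    fix c assume c: "c \<in> V" "R (m h) c"
    show "c \<in> A \<union> m ` A"
    proof (rule ccontr)
      assume n: "c \<notin> A \<union> m ` A"
      then have "alternating_path V m R a (insert c A) c" using alternating_path.extend P c by metis
      then have "card (insert c A) \<le> card A" using A by metis
      then show False using n alternating_path_subset(2)[OF P] by simp
    qed
  qed
qed

text \<open>Edmonds' blossom step: \<open>C\<close> is a factor-critical set contracted to its base \<open>b\<close>, and \<open>R'\<close> is the
  red relation after the contraction.\<close>
lemma matchable_uncontract:
  assumes "matchable (red_or_blue m R') S" "S \<subseteq> V - (C - {b})" "b \<in> C"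
    and R': "\<And>x y. R' x y \<Longrightarrow> x \<noteq> b \<Longrightarrow> y \<noteq> b \<Longrightarrow> R x y"
       "\<And>y. R' b y \<Longrightarrow> y \<noteq> b \<Longrightarrow> \<exists>v\<in>C. R v y"
       "\<And>y. R' y b \<Longrightarrow> y \<noteq> b \<Longrightarrow> \<exists>v\<in>C. R y v"
    and C: "\<And>v. v \<in> C \<Longrightarrow> matchable (red_or_blue m R) (C - {v})"
  shows "matchable (red_or_blue m R) (if b \<in> S then S \<union> C else S)"
  using assms(1,2)
proof induction
  case empty then show ?case by (simp add: matchable.empty)
next
  case (insert S x y)
  have IH: "matchable (red_or_blue m R) (if b \<in> S then S \<union> C else S)" using insert by auto
  have xy: "x \<notin> C - {b}" "y \<notin> C - {b}" "S \<inter> (C - {b}) = {}" using insert by auto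
  consider "x \<noteq> b" "y \<noteq> b" | "x = b" "y \<noteq> b" | "x \<noteq> b" "y = b" using insert.hyps(4) by metis
  then show ?case
  proof cases
    case 1
    have e: "red_or_blue m R x y" using insert 1 R'(1) by auto
    let ?T = "if b \<in> S then S \<union> C else S"
    have "(if b \<in> insert x (insert y S) then insert x (insert y S) \<union> C else insert x (insert y S))
        = insert x (insert y ?T)" using 1 by auto
    then show ?thesis using insert.hyps 1 xy e
      by - (rule matchable_insert_pair[OF IH e], auto)
  next
    case 2
    \<comment> \<open>A red edge at the base comes from a red edge at some \<open>v\<close> of
      \<open>C\<close>, and a blue one is an edge at \<open>b\<close> itself. What remains of
      \<open>C\<close> is matched because \<open>C\<close> is factor-critical.\<close>
    then obtain v where v: "v \<in> C" "red_or_blue m R v y"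
      using insert.hyps(5) R'(2)[of y] \<open>b \<in> C\<close> by auto
    have "matchable (red_or_blue m R) (S \<union> (C - {v}))"
      using IH C[OF v(1)] 2 insert.hyps xy by (intro matchable_union) auto
    moreover have "S \<inter> C = {}" "y \<notin> C" using xy 2 insert.hyps by auto
    ultimately have "matchable (red_or_blue m R) (insert v (insert y (S \<union> (C - {v}))))"
      using v insert.hyps by (intro matchable.insert) auto
    moreover have "insert v (insert y (S \<union> (C - {v}))) = insert x (insert y S) \<union> C"
      using v 2 \<open>b \<in> C\<close> by auto
    ultimately show ?thesis using 2 by simp
  next
    case 3
    have "\<exists>v\<in>C. red_or_blue m R x v"
      using insert.hyps(5) R'(3)[of x] \<open>b \<in> C\<close> 3 by auto
    then obtain v where v: "v \<in> C" "red_or_blue m R x v" by auto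
    have "matchable (red_or_blue m R) (S \<union> (C - {v}))"
      using IH C[OF v(1)] 3 insert.hyps xy by (intro matchable_union) auto
    moreover have "S \<inter> C = {}" "x \<notin> C" using xy 3 insert.hyps by auto
    ultimately have "matchable (red_or_blue m R) (insert x (insert v (S \<union> (C - {v}))))"
      using v insert.hyps by (intro matchable.insert) auto
    moreover have "insert x (insert v (S \<union> (C - {v}))) = insert x (insert y S) \<union> C"
      using v 3 \<open>b \<in> C\<close> by auto
    ultimately show ?thesis using 3 by simp
  qed
qed

text \<open>Induction over blossom contractions: the red edge leaving the end of a maximal alternating path
  closes either an alternating cycle or an odd cycle.\<close>
theorem red_edge_in_perfect_matching:
  fixes V :: "'a set"
  assumes "fpf_involution_on V m" "finite V" "V \<noteq> {}"
    and "\<And>x y. R x y \<Longrightarrow> R y x"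
    and "\<And>A. \<lbrakk>A \<subseteq> V; A \<noteq> {}; A \<noteq> V\<rbrakk> \<Longrightarrow> \<exists>x\<in>A. \<exists>y\<in>V - A. R x y"
  obtains x y T where "R x y" "x \<noteq> y" "x \<notin> T" "y \<notin> T" "V = insert x (insert y T)"
    "matchable (red_or_blue m R) T"
proof -
  have "\<exists>x y T. R x y \<and> x \<noteq> y \<and> x \<notin> T \<and> y \<notin> T \<and> V = insert x (insert y T) \<and>
    matchable (red_or_blue m R) T" using assms
  proof (induction "card V" arbitrary: V R rule: less_induct)
    case less
    note m = less.prems(1) and fin = less.prems(2) and ne = less.prems(3)
      and sym = less.prems(4) and cut = less.prems(5)
    have mV: "m p \<in> V" "m p \<noteq> p" "m (m p) = p" if "p \<in> V" for p
      using m that unfolding fpf_involution_on_def by auto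
    have rest: "matchable (red_or_blue m R) (V - B)" if "fpf_involution_on B m" "B \<subseteq> V" for B
      using fpf_involution_on_Diff[OF m that] fin by (intro matchable_fpf_involution) auto
    obtain a A h where P: "alternating_path V m R a A h"
      and mx: "\<And>c. \<lbrakk>c \<in> V; R (m h) c\<rbrakk> \<Longrightarrow> c \<in> A \<union> m ` A"
      using alternating_path_maximal[OF fin ne] by metis
    note s = alternating_path_subset[OF P]
    have mh: "m h \<in> V" using s mV by auto
    have "{m h} \<noteq> V" using mV(1)[OF mh] mV(2)[OF mh] by auto
    \<comment> \<open>Connectivity, applied to the last vertex alone, gives a red edge leaving it.
      By maximality its other end lies on the path, in one of two parities.\<close>
    then obtain c where c: "c \<in> V" "c \<noteq> m h" "R (m h) c" using cut[of "{m h}"] mh by auto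
    consider (even) "c \<in> A" | (odd) x where "x \<in> A" "c = m x" using mx[OF c(1,3)] by auto
    then show ?case
    proof cases
      case even
      then obtain A' where A': "A' \<subseteq> A" "alternating_path V m R c A' h"
        using alternating_path_suffix[OF P] by blast
      have cl: "fpf_involution_on (A' \<union> m ` A') m" "A' \<union> m ` A' \<subseteq> V"
        using involution_on_closure[OF m] A' s by auto
      define B where "B = A' \<union> m ` A'"
      have i: "matchable (red_or_blue m R) (B - {c, m h})"
        unfolding B_def using alternating_path_interior[OF A'(2) m] .
      have hc: "c \<in> B" "m h \<in> B" using alternating_path_subset[OF A'(2)] unfolding B_def by auto
      \<comment> \<open>The suffix from \<open>c\<close> to \<open>m h\<close> begins and ends with
        blue edges, so the red edge closes an alternating cycle. Exchange the colours on the cycle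
        and keep \<open>m\<close> elsewhere.\<close>
      have "matchable (red_or_blue m R) ((B - {c, m h}) \<union> (V - B))"
        using i rest[OF cl] unfolding B_def[symmetric] by (intro matchable_union) auto
      moreover have "(B - {c, m h}) \<union> (V - B) = V - {c, m h}" using hc cl B_def by auto
      ultimately have "matchable (red_or_blue m R) (V - {c, m h})" by simp
      then show ?thesis using c mh by (intro exI[of _ "m h"] exI[of _ c] exI[of _ "V - {c, m h}"]) auto
    next
      case (odd x)
      then obtain A' where A': "A' \<subseteq> A" "alternating_path V m R x A' h"
        using alternating_path_suffix[OF P] by blast
      note s' = alternating_path_subset[OF A'(2)]
      have cl: "fpf_involution_on (A' \<union> m ` A') m" "A' \<union> m ` A' \<subseteq> V"
        using involution_on_closure[OF m] A' s by auto
      have xV: "x \<in> V" using s odd by auto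
      \<comment> \<open>Without \<open>x\<close> the suffix starts at \<open>m x\<close>, which is
        \<open>c\<close>, and the red edge from \<open>m h\<close> closes it to an odd cycle. This
        is the blossom, with base \<open>b\<close> and with the blue edge from \<open>b\<close> to
        \<open>x\<close> as its stem.\<close>
      define C where "C = A' \<union> m ` A' - {x}"
      define b where "b = m x"
      have bC: "b \<in> C" and bV: "b \<in> V" and CV: "C \<subseteq> V"
        using s' mV[OF xV] cl unfolding C_def b_def by auto
      \<comment> \<open>An odd cycle is factor-critical. In the first case the edges of the path
        suffice; in the second the closing red edge between \<open>b\<close> and \<open>m h\<close>
        is one of the matching edges.\<close>
      have Cv: "matchable (red_or_blue m R) (C - {v})" if v: "v \<in> C" for v
      proof -
        consider y where "y \<in> A'" "v = m y" | "v \<in> A'" "v \<noteq> x" using v unfolding C_def by auto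
        then show ?thesis
        proof cases
          case 1
          have "C - {v} = A' \<union> m ` A' - {x, m y}" unfolding C_def 1(2) by blast
          then show ?thesis using alternating_path_minus_even[OF A'(2) m 1(1)] by simp
        next
          case 2
          have dj: "A' \<inter> m ` A' = {}" using alternating_path_disjoint[OF A'(2) m] .
          have bmh: "b \<noteq> m h" using c odd unfolding b_def by auto
          have rb: "R b (m h)" using c odd sym unfolding b_def by auto
          have i: "matchable (red_or_blue m R) ((A' \<union> m ` A') - {x, b, v, m h})"
            using alternating_path_minus_odd[OF A'(2) m 2] unfolding b_def .
          have e: "red_or_blue m R b (m h)" using rb by simp
          have "m h \<in> m ` A'" "b \<in> m ` A'" using s' unfolding b_def by auto
          then have "m h \<noteq> x" "m h \<noteq> v" "b \<noteq> x" "b \<noteq> v" using dj s' 2 by auto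
          then have "C - {v} = insert b (insert (m h) ((A' \<union> m ` A') - {x, b, v, m h}))"
            unfolding C_def using \<open>m h \<in> m ` A'\<close> \<open>b \<in> m ` A'\<close> by auto
          then show ?thesis by - (rule matchable_insert_pair[OF i e bmh], auto)
        qed
      qed
      have mhC: "m h \<in> C" "m h \<noteq> b"
      proof -
        have "x \<notin> m ` A'" using alternating_path_disjoint[OF A'(2) m] s' by auto
        then show "m h \<in> C" using s' unfolding C_def by auto
        show "m h \<noteq> b" using c odd unfolding b_def by auto
      qed
      \<comment> \<open>The base stands for the contracted blossom. Its blue partner
        \<open>x\<close> lies outside \<open>C\<close>, so the deleted vertices are closed under
        \<open>m\<close>, which remains a perfect matching of \<open>V'\<close>.\<close>
      define V' where "V' = V - (C - {b})"
      have VV': "V = V' \<union> C" using CV unfolding V'_def by auto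
      have Vfin: "finite V'" "V' \<noteq> {}" "card V' < card V"
      proof -
        show "finite V'" "V' \<noteq> {}" unfolding V'_def using fin bV by auto
        show "card V' < card V" unfolding V'_def using fin mhC mh by (intro psubset_card_mono) auto
      qed
      have invC: "fpf_involution_on (C - {b}) m"
      proof -
        have "fpf_involution_on {x, b} m" using mV[OF xV] unfolding fpf_involution_on_def b_def by auto
        moreover have "{x, b} \<subseteq> A' \<union> m ` A'" using s' unfolding b_def by auto
        ultimately have "fpf_involution_on (A' \<union> m ` A' - {x, b}) m"
          using fpf_involution_on_Diff[OF cl(1)] by blast
        moreover have "A' \<union> m ` A' - {x, b} = C - {b}" unfolding C_def by auto
        ultimately show ?thesis by simp
      qed
      then have mV': "fpf_involution_on V' m"
        unfolding V'_def using CV by (intro fpf_involution_on_Diff[OF m]) auto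
      define R' where "R' = (\<lambda>y z. R y z \<and> y \<noteq> b \<and> z \<noteq> b
          \<or> y = b \<and> (\<exists>v\<in>C. R v z) \<or> z = b \<and> (\<exists>v\<in>C. R y v))"
      have sym': "R' y z \<Longrightarrow> R' z y" for y z using sym unfolding R'_def by blast
      have cut': "\<exists>y\<in>B. \<exists>z\<in>V' - B. R' y z" if B: "B \<subseteq> V'" "B \<noteq> {}" "B \<noteq> V'" for B
      proof (cases "b \<in> B")
        case True
        \<comment> \<open>A cut of the contracted graph lifts to a cut of \<open>V\<close> once the
          side containing \<open>b\<close> is enlarged by the whole blossom.\<close>
        have "B \<union> C \<noteq> V" using B True unfolding V'_def by blast
        then obtain y z where yz: "y \<in> B \<union> C" "z \<in> V - (B \<union> C)" "R y z"
          using cut[of "B \<union> C"] B CV V'_def by auto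
        then have z: "z \<in> V' - B" "z \<noteq> b" unfolding V'_def using bC by auto
        show ?thesis
        proof (cases "y \<in> C")
          case True then show ?thesis using z yz \<open>b \<in> B\<close> unfolding R'_def by blast
        next
          case False then show ?thesis using z yz bC unfolding R'_def by blast
        qed
      next
        case False
        have "B \<noteq> V" using bV False by auto
        then obtain y z where yz: "y \<in> B" "z \<in> V - B" "R y z"
          using cut[of B] B V'_def by auto
        have y: "y \<noteq> b" using yz False by auto
        have bV': "b \<in> V' - B" using bV False unfolding V'_def by auto
        show ?thesis
        proof (cases "z \<in> C")
          case True then show ?thesis using y yz bV' unfolding R'_def by blast
        next
          case False
          then have "z \<in> V' - B" "z \<noteq> b" using yz bC unfolding V'_def by auto
          then show ?thesis using y yz unfolding R'_def by blast
        qed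
      qed
      obtain p q T where pq: "R' p q" "p \<noteq> q" "p \<notin> T" "q \<notin> T" "V' = insert p (insert q T)"
          "matchable (red_or_blue m R') T"
        using less.hyps[OF Vfin(3) mV' Vfin(1,2) sym' cut'] by auto
      have TV: "T \<subseteq> V - (C - {b})" using pq(5) unfolding V'_def by auto
      have M: "matchable (red_or_blue m R) (if b \<in> T then T \<union> C else T)"
        using pq(6) TV bC by (rule matchable_uncontract) (auto simp: R'_def intro: Cv)
      show ?thesis
      proof (cases "b \<in> T")
        case True
        then have "p \<noteq> b" "q \<noteq> b" using pq by auto
        then have "R p q" using pq(1) unfolding R'_def by auto
        moreover have "p \<notin> C" "q \<notin> C" using \<open>p \<noteq> b\<close> \<open>q \<noteq> b\<close> pq(5) unfolding V'_def by auto
        moreover have "V = insert p (insert q (T \<union> C))" using pq(5) True VV' bC by auto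
        ultimately show ?thesis using M True pq
          by (intro exI[of _ p] exI[of _ q] exI[of _ "T \<union> C"]) auto
      next
        case False
        \<comment> \<open>Here the distinguished red edge itself meets the contracted vertex. It
          lifts to a red edge at some \<open>v\<close> in \<open>C\<close>, and
          \<open>C - {v}\<close> is added to the matching.\<close>
        then have "p = b \<or> q = b" using pq(5) bV unfolding V'_def by auto
        then obtain q' where q': "q' \<noteq> b" "q' \<notin> T" "V' = insert b (insert q' T)" "R' b q'"
          using pq sym' by (metis insert_commute)
        then obtain v where v: "v \<in> C" "R v q'" unfolding R'_def using bC by auto
        have q'C: "q' \<notin> C" "T \<inter> C = {}" using q' False unfolding V'_def by auto
        have "matchable (red_or_blue m R) (T \<union> (C - {v}))"
          using M False Cv[OF v(1)] q'C by (intro matchable_union) auto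
        moreover have "V = insert v (insert q' (T \<union> (C - {v})))"
          using q'(3) VV' bC v(1) by auto
        ultimately show ?thesis using v q' q'C
          by (intro exI[of _ v] exI[of _ q'] exI[of _ "T \<union> (C - {v})"]) auto
      qed
    qed
  qed
  then show ?thesis using that by blast
qed

text \<open>A perfect matching through a red edge differs from \<open>m\<close> at the ends of that
  edge, because no blue edge is red.\<close>

lemma another_perfect_matching:
  assumes "fpf_involution_on V m" "finite V" "V \<noteq> {}"
    and "\<And>x y. R x y \<Longrightarrow> R y x" "\<And>x. x \<in> V \<Longrightarrow> \<not> R x (m x)"
    and "\<And>A. \<lbrakk>A \<subseteq> V; A \<noteq> {}; A \<noteq> V\<rbrakk> \<Longrightarrow> \<exists>x\<in>A. \<exists>y\<in>V - A. R x y"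
  obtains n x where "fpf_involution_on V n" "\<And>p. p \<in> V \<Longrightarrow> n p = m p \<or> R p (n p)" "x \<in> V" "n x \<noteq> m x"
proof -
  obtain x y T where xyT: "R x y" "x \<noteq> y" "x \<notin> T" "y \<notin> T" "V = insert x (insert y T)"
    "matchable (red_or_blue m R) T"
    by (rule red_edge_in_perfect_matching[OF assms(1-4,6)])
  obtain n where n: "fpf_involution_on T n" "\<And>p. p \<in> T \<Longrightarrow> red_or_blue m R p (n p) \<or> red_or_blue m R (n p) p"
    by (rule matchable_imp_fpf_involution[OF xyT(6)]) blast
  let ?n = "n(x := y, y := x)"
  have mm: "m (m p) = p" if "p \<in> V" for p using assms(1) that unfolding fpf_involution_on_def by auto
  show ?thesis
  proof (rule that[of ?n x])
    show "fpf_involution_on V ?n" using n(1) xyT unfolding fpf_involution_on_def by auto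
    show "?n p = m p \<or> R p (?n p)" if "p \<in> V" for p
    proof (cases "p \<in> T")
      case True
      have "n p \<in> T" using n(1) True unfolding fpf_involution_on_def by auto
      then have "n p = m p \<or> R p (n p)"
        using n(2)[OF True] mm[of "n p"] assms(4) xyT(5) by auto
      then show ?thesis using True xyT by auto
    next
      case False then show ?thesis using that xyT assms(4) by auto
    qed
    show "x \<in> V" using xyT by auto
    show "?n x \<noteq> m x" using assms(5)[OF \<open>x \<in> V\<close>] xyT by auto
  qed
qed

section \<open>Perfect matchings whose diametral balls intersect\<close>

text \<open>It is at most 0 exactly when \<open>z\<close> lies in the ball with diameter
  \<open>p q\<close>, that is, when \<open>p\<close> and \<open>q\<close> subtend at least a right
  angle at \<open>z\<close> or \<open>z\<close> is one of them.\<close>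

definition shifted_inner :: "nat \<Rightarrow> (nat \<Rightarrow> real) \<Rightarrow> (nat \<Rightarrow> real) \<Rightarrow> (nat \<Rightarrow> real) \<Rightarrow> real" where
  "shifted_inner d z p q = (\<Sum>i<d. (p i - z i) * (q i - z i))"

text \<open>For a perfect matching it vanishes exactly when \<open>z\<close> lies in all diametral
  balls. Squaring the positive part makes it differentiable in \<open>z\<close>; every pair is
  counted from both ends.\<close>

definition penalty :: "nat \<Rightarrow> (nat \<Rightarrow> real) set \<Rightarrow> ((nat \<Rightarrow> real) \<Rightarrow> (nat \<Rightarrow> real)) \<Rightarrow> (nat \<Rightarrow> real) \<Rightarrow> real" where
  "penalty d P m z = (\<Sum>p\<in>P. (max 0 (shifted_inner d z p (m p)))\<^sup>2)"

lemma shifted_inner_commute: "shifted_inner d z p q = shifted_inner d z q p"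
  unfolding shifted_inner_def by (simp add: mult.commute)

lemma continuous_on_penalty: "continuous_on S (penalty d P m)"
proof -
  have c: "continuous_on S (\<lambda>z. z i)" for i :: nat and S :: "(nat \<Rightarrow> real) set"
    by (rule continuous_on_subset[OF continuous_on_product_coordinates subset_UNIV])
  show ?thesis unfolding penalty_def shifted_inner_def by (intro continuous_intros c)
qed

text \<open>Points are total functions on \<open>nat\<close> with the product topology, so
  compactness comes from Tychonoff's theorem and every coordinate has to be bounded, not only the
  first \<open>d\<close>.\<close>

lemma compact_box: "compact {z :: nat \<Rightarrow> real. \<forall>i. \<bar>z i\<bar> \<le> B}"
proof -
  have "compactin (product_topology (\<lambda>i. euclidean) UNIV) (PiE UNIV (\<lambda>i::nat. {-B..B::real}))"
    by (subst compactin_PiE) auto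
  then have "compact (PiE UNIV (\<lambda>i::nat. {-B..B::real}))"
    unfolding euclidean_product_topology compactin_euclidean_iff .
  moreover have "PiE UNIV (\<lambda>i::nat. {-B..B::real}) = {z. \<forall>i. \<bar>z i\<bar> \<le> B}"
    by (auto simp: abs_le_iff PiE_iff minus_le_iff)
  ultimately show ?thesis by (simp only:)
qed

text \<open>If \<open>z\<close> lies outside the interval, then both differences have the same sign,
  and moving \<open>z\<close> to the nearer end shortens both of them.\<close>

lemma clamp_product_le:
  fixes a b z B :: real
  assumes "\<bar>a\<bar> \<le> B" "\<bar>b\<bar> \<le> B"
  shows "(a - max (-B) (min B z)) * (b - max (-B) (min B z)) \<le> (a - z) * (b - z)"
proof -
  consider "z > B" | "z < -B" | "-B \<le> z" "z \<le> B" by linarith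
  then show ?thesis
  proof cases
    case 1
    then have "max (-B) (min B z) = B" using assms by auto
    moreover have "(B - a) * (B - b) \<le> (z - a) * (z - b)" using 1 assms by (intro mult_mono) auto
    ultimately show ?thesis by (simp add: algebra_simps)
  next
    case 2
    then have "max (-B) (min B z) = -B" using assms by auto
    moreover have "(a + B) * (b + B) \<le> (a - z) * (b - z)" using 2 assms by (intro mult_mono) auto
    ultimately show ?thesis by (simp add: algebra_simps)
  next
    case 3 then show ?thesis by simp
  qed
qed

text \<open>Clamping every coordinate of \<open>z\<close> to a box around \<open>P\<close> does not increase the penalty.\<close>
lemma penalty_attains_min:
  assumes "finite P" "fpf_involution_on P m"
  obtains z where "\<And>y. penalty d P m z \<le> penalty d P m y"
proof -
  define B where "B = (\<Sum>p\<in>P. \<Sum>i<d. \<bar>p i\<bar>)"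
  have B: "\<bar>p i\<bar> \<le> B" if "p \<in> P" "i < d" for p i
  proof -
    have "\<bar>p i\<bar> \<le> (\<Sum>i<d. \<bar>p i\<bar>)" using that by (intro member_le_sum) auto
    also have "\<dots> \<le> B" unfolding B_def using that assms
      by (intro member_le_sum[of p P "\<lambda>p. \<Sum>i<d. \<bar>p i\<bar>"]) (auto intro: sum_nonneg)
    finally show ?thesis .
  qed
  have B0: "B \<ge> 0" unfolding B_def by (intro sum_nonneg) auto
  let ?K = "{z :: nat \<Rightarrow> real. \<forall>i. \<bar>z i\<bar> \<le> B}"
  have "(\<lambda>_. 0) \<in> ?K" using B0 by auto
  then have ne: "?K \<noteq> {}" by (simp only: ex_in_conv[symmetric]) (rule exI[of _ "\<lambda>_. 0"])
  obtain z where z: "z \<in> ?K" "\<forall>y\<in>?K. penalty d P m z \<le> penalty d P m y"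
    by (rule bexE[OF continuous_attains_inf[OF compact_box ne continuous_on_penalty]])
  have "penalty d P m z \<le> penalty d P m y" for y
  proof -
    define y' where "y' = (\<lambda>i. max (-B) (min B (y i)))"
    have "y' \<in> ?K" using B0 unfolding y'_def by auto
    then have "penalty d P m z \<le> penalty d P m y'" using z by blast
    also have "\<dots> \<le> penalty d P m y"
      unfolding penalty_def
    proof (intro sum_mono power_mono max.mono)
      fix p assume p: "p \<in> P"
      then have "m p \<in> P" using assms unfolding fpf_involution_on_def by auto
      then show "shifted_inner d y' p (m p) \<le> shifted_inner d y p (m p)"
        unfolding shifted_inner_def y'_def using B p by (intro sum_mono clamp_product_le) auto
    qed auto
    finally show ?thesis .
  qed
  then show ?thesis by (rule that)
qed

text \<open>The two sides agree at \<open>e = 0\<close> and the right one is polynomial in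
  \<open>e\<close>, which makes it a smooth majorant.\<close>

lemma positive_part_square_perturb:
  "(max 0 (x + e))\<^sup>2 \<le> (max 0 x + e)\<^sup>2" for x e :: real
proof (cases "x + e \<le> 0")
  case False
  then show ?thesis by (intro power_mono) (auto simp: max_def)
qed (simp add: max_def)

lemma sum_involution:
  assumes "fpf_involution_on P m"
  shows "(\<Sum>p\<in>P. f (m p)) = (\<Sum>p\<in>P. f p)"
  by (rule sum.reindex_bij_witness[of _ m m]) (use assms in \<open>auto simp: fpf_involution_on_def\<close>)

text \<open>The penalty is not differentiated directly: at \<open>z\<close> it is touched from above by the smooth function
  \<open>f\<close> of \<open>positive_part_square_perturb\<close>, which therefore also has a minimum there.\<close>
lemma penalty_stationary:
  assumes "finite P" "fpf_involution_on P m" "\<And>y. penalty d P m z \<le> penalty d P m y" "k < d"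
  shows "(\<Sum>p\<in>P. max 0 (shifted_inner d z p (m p)) * (p k - z k)) = 0"
proof -
  let ?l = "\<lambda>p. max 0 (shifted_inner d z p (m p))"
  let ?e = "\<lambda>p s. s\<^sup>2 - s * ((p k - z k) + (m p k - z k))"
  define f where "f = (\<lambda>s. \<Sum>p\<in>P. (?l p + ?e p s)\<^sup>2)"
  have shift: "shifted_inner d (z(k := z k + s)) p q
      = shifted_inner d z p q + (s\<^sup>2 - s * ((p k - z k) + (q k - z k)))" for p q s
  proof -
    have "shifted_inner d (z(k := z k + s)) p q - shifted_inner d z p q
       = (\<Sum>i<d. if i = k then s\<^sup>2 - s * ((p k - z k) + (q k - z k)) else 0)"
      unfolding shifted_inner_def sum_subtractf[symmetric]
      by (intro sum.cong) (auto simp: algebra_simps power2_eq_square)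
    also have "\<dots> = s\<^sup>2 - s * ((p k - z k) + (q k - z k))" using assms(4) by simp
    finally show ?thesis by simp
  qed
  have min: "f 0 \<le> f s" for s
  proof -
    have "f 0 = penalty d P m z" unfolding f_def penalty_def by simp
    also have "\<dots> \<le> penalty d P m (z(k := z k + s))" using assms(3) .
    also have "\<dots> \<le> f s" unfolding f_def penalty_def shift
      by (intro sum_mono positive_part_square_perturb)
    finally show ?thesis .
  qed
  have "(f has_field_derivative (\<Sum>p\<in>P. 2 * ?l p * (- ((p k - z k) + (m p k - z k))))) (at 0)"
    unfolding f_def by (auto intro!: derivative_eq_intros sum.cong simp: algebra_simps)
  then have "(\<Sum>p\<in>P. 2 * ?l p * (- ((p k - z k) + (m p k - z k)))) = 0"
    using DERIV_local_min[of f _ 0 1] min by auto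
  moreover have "(\<Sum>p\<in>P. 2 * ?l p * (- ((p k - z k) + (m p k - z k))))
      = -2 * ((\<Sum>p\<in>P. ?l p * (p k - z k)) + (\<Sum>p\<in>P. ?l p * (m p k - z k)))"
    unfolding sum.distrib[symmetric] sum_distrib_left
    by (intro sum.cong) (auto simp: algebra_simps)
  \<comment> \<open>The weight of \<open>p\<close> is also the weight of \<open>m p\<close>, so
    reindexing by \<open>m\<close> folds the partner terms onto the first sum.\<close>
  moreover have "(\<Sum>p\<in>P. ?l p * (m p k - z k)) = (\<Sum>p\<in>P. ?l (m p) * (m p k - z k))"
    using assms(2) by (intro sum.cong) (auto simp: fpf_involution_on_def shifted_inner_commute)
  moreover have "\<dots> = (\<Sum>p\<in>P. ?l p * (p k - z k))"
    using sum_involution[OF assms(2), of "\<lambda>p. ?l p * (p k - z k)"] .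
  ultimately show ?thesis by simp
qed

text \<open>Restricted to \<open>P\<close>, the partner functions are finite in number, and each of
  them has a best \<open>z\<close>.\<close>

lemma exists_min_penalty:
  assumes "finite P" "even (card P)"
  obtains m z where "fpf_involution_on P m"
    "\<And>n y. fpf_involution_on P n \<Longrightarrow> penalty d P m z \<le> penalty d P n y"
proof -
  let ?I = "{m \<in> P \<rightarrow>\<^sub>E P. fpf_involution_on P m}"
  have fin: "finite ?I" using assms finite_PiE[of P "\<lambda>_. P"] by auto
  have restrict: "restrict n P \<in> ?I" "penalty d P (restrict n P) y = penalty d P n y"
    if "fpf_involution_on P n" for n y
    using that unfolding fpf_involution_on_def penalty_def by auto
  obtain n0 where "fpf_involution_on P n0"
    using matchable_imp_fpf_involution[OF matchable_even_card[OF assms]] by metis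
  then have "?I \<noteq> {}" using restrict(1) by blast
  have "\<exists>z. \<forall>y. penalty d P m z \<le> penalty d P m y" if "m \<in> ?I" for m
    using penalty_attains_min[OF assms(1), of m d] that by blast
  then obtain Z where Z: "\<And>m y. m \<in> ?I \<Longrightarrow> penalty d P m (Z m) \<le> penalty d P m y"
    by (metis (no_types, lifting))
  define m where "m = arg_min_on (\<lambda>m. penalty d P m (Z m)) ?I"
  have m: "m \<in> ?I" unfolding m_def using arg_min_if_finite(1)[OF fin \<open>?I \<noteq> {}\<close>] .
  have mm: "penalty d P m (Z m) \<le> penalty d P n (Z n)" if "n \<in> ?I" for n
    unfolding m_def using arg_min_least[OF fin \<open>?I \<noteq> {}\<close> that] .
  show ?thesis
  proof (rule that)
    show "fpf_involution_on P m" using m by simp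
    show "penalty d P m (Z m) \<le> penalty d P n y" if "fpf_involution_on P n" for n y
      using mm[OF restrict(1)[OF that]] Z[OF restrict(1)[OF that], of y] restrict(2)[OF that, of y] by linarith
  qed
qed

lemma diametral_balls_intersect:
  assumes "finite P" "even (card P)"
  obtains m z where "fpf_involution_on P m" "\<And>p. p \<in> P \<Longrightarrow> shifted_inner d z p (m p) \<le> 0"
proof -
  obtain m z where m: "fpf_involution_on P m"
    and min: "\<And>n y. fpf_involution_on P n \<Longrightarrow> penalty d P m z \<le> penalty d P n y"
    using exists_min_penalty[OF assms] by metis
  define V where "V = {p \<in> P. shifted_inner d z p (m p) > 0}"
  define R where "R = (\<lambda>p q. shifted_inner d z p q \<le> 0)"
  define l where "l = (\<lambda>p. max 0 (shifted_inner d z p (m p)))"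
  have mP: "m p \<in> P" "m p \<noteq> p" "m (m p) = p" if "p \<in> P" for p
    using m that unfolding fpf_involution_on_def by auto
  have lV: "l p > 0" if "p \<in> V" for p using that unfolding V_def l_def by auto
  have l0: "l p = 0" if "p \<in> P - V" for p using that unfolding V_def l_def by auto
  \<comment> \<open>Points outside \<open>V\<close> have weight 0, so stationarity says that
    \<open>z\<close> is the barycentre of \<open>V\<close> with the positive weights
    \<open>l\<close>.\<close>
  have stat: "(\<Sum>p\<in>V. l p * (p k - z k)) = 0" if "k < d" for k
  proof -
    have "(\<Sum>p\<in>P. l p * (p k - z k)) = 0"
      using penalty_stationary[OF assms(1) m min[OF m] that] unfolding l_def .
    moreover have "(\<Sum>p\<in>V. l p * (p k - z k)) = (\<Sum>p\<in>P. l p * (p k - z k))"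
      using assms(1) l0 by (intro sum.mono_neutral_left) (auto simp: V_def)
    ultimately show ?thesis by simp
  qed
  have "V = {}"
  proof (rule ccontr)
    assume ne: "V \<noteq> {}"
    have mV: "fpf_involution_on V m"
      using mP unfolding fpf_involution_on_def V_def by (auto simp: shifted_inner_commute)
    have fin: "finite V" using assms unfolding V_def by auto
    have cut: "\<exists>x\<in>A. \<exists>y\<in>V - A. R x y" if A: "A \<subseteq> V" "A \<noteq> {}" "A \<noteq> V" for A
    proof (rule ccontr)
      assume n: "\<not> (\<exists>x\<in>A. \<exists>y\<in>V - A. R x y)"
      have finA: "finite A" using A fin finite_subset by auto
      \<comment> \<open>With no edge of \<open>R\<close> across the cut this weighted sum of inner
        products is positive. It is also the inner product of the weighted sums over
        \<open>A\<close> and \<open>V - A\<close>, which are opposite vectors by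
        \<open>stat\<close>, hence minus a squared length.\<close>
      have "(\<Sum>x\<in>A. \<Sum>y\<in>V - A. l x * l y * shifted_inner d z x y) > 0"
      proof (intro sum_pos finA A(2))
        fix x y assume "x \<in> A" "y \<in> V - A"
        then show "l x * l y * shifted_inner d z x y > 0"
          using n lV A unfolding R_def by (intro mult_pos_pos) (auto simp: not_le)
      qed (use fin A in auto)
      moreover have "(\<Sum>x\<in>A. \<Sum>y\<in>V - A. l x * l y * shifted_inner d z x y)
         = (\<Sum>x\<in>A. \<Sum>y\<in>V - A. \<Sum>k<d. (l x * (x k - z k)) * (l y * (y k - z k)))"
        unfolding shifted_inner_def sum_distrib_left by (intro sum.cong) (auto simp: algebra_simps)
      moreover have "\<dots> = (\<Sum>x\<in>A. \<Sum>k<d. \<Sum>y\<in>V - A. (l x * (x k - z k)) * (l y * (y k - z k)))"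
        by (intro sum.cong refl sum.swap)
      moreover have "\<dots> = (\<Sum>k<d. \<Sum>x\<in>A. \<Sum>y\<in>V - A. (l x * (x k - z k)) * (l y * (y k - z k)))"
        by (rule sum.swap)
      moreover have "\<dots> = (\<Sum>k<d. (\<Sum>x\<in>A. l x * (x k - z k)) * (\<Sum>y\<in>V - A. l y * (y k - z k)))"
        by (simp add: sum_product)
      moreover have "\<dots> = (\<Sum>k<d. - (\<Sum>x\<in>A. l x * (x k - z k))\<^sup>2)"
      proof (intro sum.cong refl)
        fix k assume "k \<in> {..<d}"
        then have "(\<Sum>y\<in>V - A. l y * (y k - z k)) = - (\<Sum>x\<in>A. l x * (x k - z k))"
          using stat[of k] sum.subset_diff[OF A(1) fin, of "\<lambda>y. l y * (y k - z k)"] by simp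
        then show "(\<Sum>x\<in>A. l x * (x k - z k)) * (\<Sum>y\<in>V - A. l y * (y k - z k))
            = - (\<Sum>x\<in>A. l x * (x k - z k))\<^sup>2" by (simp add: power2_eq_square)
      qed
      moreover have "\<dots> \<le> 0" by (intro sum_nonpos) auto
      ultimately show False by linarith
    qed
    have Rsym: "R y x" if "R x y" for x y using that unfolding R_def by (simp add: shifted_inner_commute)
    have nb: "\<not> R x (m x)" if "x \<in> V" for x using that unfolding R_def V_def by auto
    have "\<exists>n x. fpf_involution_on V n \<and> (\<forall>p\<in>V. n p = m p \<or> R p (n p)) \<and> x \<in> V \<and> n x \<noteq> m x"
      by (rule another_perfect_matching[OF mV fin ne Rsym nb cut]) blast+
    then obtain n x where n: "fpf_involution_on V n" "\<And>p. p \<in> V \<Longrightarrow> n p = m p \<or> R p (n p)"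
      "x \<in> V" "n x \<noteq> m x" by blast
    \<comment> \<open>Partners change on \<open>V\<close> only; \<open>V\<close> and its complement
      in \<open>P\<close> are both closed under \<open>m\<close>.\<close>
    define n' where "n' = (\<lambda>p. if p \<in> V then n p else m p)"
    have VP: "V \<subseteq> P" unfolding V_def by auto
    have mnV: "m p \<notin> V" if "p \<in> P - V" for p
      using mV that mP unfolding fpf_involution_on_def by (metis DiffD1 DiffD2)
    have "fpf_involution_on P n'"
      unfolding fpf_involution_on_def
    proof
      fix p assume p: "p \<in> P"
      show "n' p \<in> P \<and> n' p \<noteq> p \<and> n' (n' p) = p"
      proof (cases "p \<in> V")
        case True
        then show ?thesis using n(1) VP unfolding fpf_involution_on_def n'_def by auto
      next
        case False
        then show ?thesis using mnV[of p] mP[OF p] p unfolding n'_def by auto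
      qed
    qed
    then have "penalty d P m z \<le> penalty d P n' z" by (rule min)
    \<comment> \<open>Off \<open>V\<close> nothing changes. On \<open>V\<close> a term either keeps
      its partner or drops to 0, and the positive term at \<open>x\<close> does drop.\<close>
    moreover have "penalty d P n' z < penalty d P m z"
      unfolding penalty_def
    proof (rule sum_strict_mono_ex1)
      show "\<forall>p\<in>P. (max 0 (shifted_inner d z p (n' p)))\<^sup>2 \<le> (max 0 (shifted_inner d z p (m p)))\<^sup>2"
      proof
        fix p assume p: "p \<in> P"
        show "(max 0 (shifted_inner d z p (n' p)))\<^sup>2 \<le> (max 0 (shifted_inner d z p (m p)))\<^sup>2"
        proof (cases "p \<in> V")
          case True
          then show ?thesis using n(2)[OF True] unfolding n'_def R_def by (auto simp: max_def)
        qed (simp add: n'_def)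
      qed
      show "\<exists>p\<in>P. (max 0 (shifted_inner d z p (n' p)))\<^sup>2 < (max 0 (shifted_inner d z p (m p)))\<^sup>2"
      proof (intro bexI[of _ x])
        have "R x (n x)" using n by auto
        then show "(max 0 (shifted_inner d z x (n' x)))\<^sup>2 < (max 0 (shifted_inner d z x (m x)))\<^sup>2"
          using n(3) unfolding n'_def R_def V_def by (auto simp: max_def)
        show "x \<in> P" using n(3) VP by auto
      qed
    qed (rule assms(1))
    ultimately show False by simp
  qed
  then show ?thesis using that[OF m, of z] unfolding V_def by force
qed

section \<open>Optimal matchings\<close>

lemma finite_matchings: "finite Q \<Longrightarrow> finite {M. is_matching Q M}"
  by (rule finite_subset[of _ "Pow (Q \<times> Q)"]) (auto simp: is_matching_def)

lemma is_matching_finite: "\<lbrakk>is_matching Q M; finite Q\<rbrakk> \<Longrightarrow> finite M"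
  unfolding is_matching_def by (metis finite_SigmaI finite_subset)

lemma is_matching_empty: "is_matching Q {}"
  unfolding is_matching_def by simp

lemma matching_sums_eq:
  "{(\<Sum>(p,q)\<in>M. \<delta> p q) | M. is_matching Q M} = (\<lambda>M. \<Sum>(p,q)\<in>M. \<delta> p q) ` {M. is_matching Q M}"
  by auto

lemma opt_max_match_ge:
  assumes "finite Q" "is_matching Q M"
  shows "(\<Sum>(p,q)\<in>M. \<delta> p q) \<le> opt_max_match \<delta> Q"
  unfolding opt_max_match_def matching_sums_eq using assms finite_matchings by (intro Max_ge) auto

lemma opt_max_match_attained:
  assumes "finite Q"
  obtains M where "is_matching Q M" "opt_max_match \<delta> Q = (\<Sum>(p,q)\<in>M. \<delta> p q)"
proof -
  have "opt_max_match \<delta> Q \<in> (\<lambda>M. \<Sum>(p,q)\<in>M. \<delta> p q) ` {M. is_matching Q M}"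
    unfolding opt_max_match_def matching_sums_eq using finite_matchings[OF assms] is_matching_empty[of Q]
    by (intro Max_in) auto
  then show ?thesis using that by auto
qed

lemma opt_max_match_nonneg: "finite Q \<Longrightarrow> 0 \<le> opt_max_match \<delta> Q"
  using opt_max_match_ge[OF _ is_matching_empty, of Q \<delta>] by simp

text \<open>The cardinality condition is the equality case of the bound of the number of endpoints
  by \<open>card (fst\<close> M) + card (snd \<open>M)\<close>, and of this by
  \<open>2 * card M\<close>.\<close>

lemma is_matching_ends:
  assumes "is_matching Q M" "finite Q"
  shows "inj_on fst M" "inj_on snd M" "fst ` M \<inter> snd ` M = {}" "fst ` M \<union> snd ` M \<subseteq> Q"
proof -
  have fin: "finite M" using is_matching_finite assms by metis
  have c: "card (fst ` M \<union> snd ` M) = 2 * card M" using assms(1) unfolding is_matching_def by simp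
  have "card (fst ` M) \<le> card M" "card (snd ` M) \<le> card M" using card_image_le[OF fin] by auto
  moreover have "card (fst ` M) + card (snd ` M) = card (fst ` M \<union> snd ` M) + card (fst ` M \<inter> snd ` M)"
    using fin by (intro card_Un_Int) auto
  ultimately have e: "card (fst ` M) = card M" "card (snd ` M) = card M" "card (fst ` M \<inter> snd ` M) = 0"
    using c by linarith+
  show "inj_on fst M" "inj_on snd M" using e fin by (auto intro: eq_card_imp_inj_on)
  show "fst ` M \<inter> snd ` M = {}" using e fin by (simp add: card_eq_0_iff)
  show "fst ` M \<union> snd ` M \<subseteq> Q" using assms(1) unfolding is_matching_def by auto
qed

text \<open>Every point is an endpoint of at most one edge, and uncovered points contribute
  nonnegative terms.\<close>

lemma is_matching_sum_ends_le:
  fixes f :: "'a \<Rightarrow> real"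
  assumes "is_matching Q M" "finite Q" "\<And>q. q \<in> Q \<Longrightarrow> 0 \<le> f q"
  shows "(\<Sum>(p,q)\<in>M. f p + f q) \<le> sum f Q"
proof -
  note e = is_matching_ends[OF assms(1,2)]
  have fin: "finite M" using is_matching_finite assms by metis
  have "(\<Sum>(p,q)\<in>M. f p + f q) = (\<Sum>x\<in>M. f (fst x)) + (\<Sum>x\<in>M. f (snd x))"
    by (simp add: case_prod_unfold sum.distrib)
  also have "\<dots> = sum f (fst ` M) + sum f (snd ` M)"
    using e by (simp add: sum.reindex)
  also have "\<dots> = sum f (fst ` M \<union> snd ` M)"
    using e fin by (intro sum.union_disjoint[symmetric]) auto
  also have "\<dots> \<le> sum f Q" using e assms by (intro sum_mono2) auto
  finally show ?thesis .
qed

text \<open>In the applications \<open>f\<close> is the distance to a fixed centre and the first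
  bound is the triangle inequality through that centre.\<close>

lemma opt_max_match_le_star:
  assumes "finite Q" "\<And>p q. \<lbrakk>p \<in> Q; q \<in> Q\<rbrakk> \<Longrightarrow> \<delta> p q \<le> f p + f q" "\<And>q. q \<in> Q \<Longrightarrow> 0 \<le> f q"
  shows "opt_max_match \<delta> Q \<le> sum f Q"
proof -
  obtain M where M: "is_matching Q M" "opt_max_match \<delta> Q = (\<Sum>(p,q)\<in>M. \<delta> p q)"
    using opt_max_match_attained[OF assms(1)] by metis
  have "(\<Sum>(p,q)\<in>M. \<delta> p q) \<le> (\<Sum>(p,q)\<in>M. f p + f q)"
    using M(1) assms(2) unfolding is_matching_def by (intro sum_mono) auto
  then show ?thesis using is_matching_sum_ends_le[OF M(1) assms(1), of f] assms(3) M(2) by simp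
qed

lemma fpf_involution_sum_le_opt:
  assumes "finite Q" "fpf_involution_on Q m" "\<And>p q. \<delta> p q = \<delta> q p"
  shows "(\<Sum>p\<in>Q. \<delta> p (m p)) \<le> 2 * opt_max_match \<delta> Q"
proof -
  \<comment> \<open>Orienting each pair once gives \<open>M\<close>, and the sum over points counts
    each edge twice. The induction also carries that \<open>M\<close> covers \<open>Q\<close>, from
    which the cardinality condition for the enlarged matching follows.\<close>
  have "\<exists>M. is_matching Q M \<and> fst ` M \<union> snd ` M = Q \<and> (\<Sum>p\<in>Q. \<delta> p (m p)) = 2 * (\<Sum>(p,q)\<in>M. \<delta> p q)"
    using assms(1,2)
  proof (induction "card Q" arbitrary: Q rule: less_induct)
    case less
    show ?case
    proof (cases "Q = {}")
      case True then show ?thesis using is_matching_empty by auto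
    next
      case False
      obtain a T where aT: "a \<in> Q" "Q = insert a (insert (m a) T)" "a \<noteq> m a" "a \<notin> T" "m a \<notin> T"
        "fpf_involution_on T m" "card T < card Q" "T \<subseteq> Q"
        by (rule fpf_involution_on_cases[OF less.prems(2,1) False])
      have finT: "finite T" using aT less.prems finite_subset by auto
      obtain M where M: "is_matching T M" "fst ` M \<union> snd ` M = T"
        "(\<Sum>p\<in>T. \<delta> p (m p)) = 2 * (\<Sum>(p,q)\<in>M. \<delta> p q)"
        using less.hyps[OF aT(7) finT aT(6)] by auto
      have finM: "finite M" using is_matching_finite M finT by metis
      have aM: "(a, m a) \<notin> M" using M(1) aT(4) unfolding is_matching_def by auto
      have mm: "m (m a) = a" using less.prems(2) aT(1) unfolding fpf_involution_on_def by auto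
      have un: "fst ` insert (a, m a) M \<union> snd ` insert (a, m a) M = Q" using M(2) aT(2) by auto
      have "card Q = 2 + card T" using aT finT by simp
      also have "card T = 2 * card M" using M(1,2) unfolding is_matching_def by simp
      finally have "card (fst ` insert (a, m a) M \<union> snd ` insert (a, m a) M) = 2 * card (insert (a, m a) M)"
        using un aM finM by simp
      then have "is_matching Q (insert (a, m a) M)"
        using M(1) aT unfolding is_matching_def by auto
      moreover have "(\<Sum>p\<in>Q. \<delta> p (m p)) = 2 * (\<Sum>(p,q)\<in>insert (a, m a) M. \<delta> p q)"
        using aT M(3) finM finT aM mm assms(3)[of "m a" a] by simp
      ultimately show ?thesis using un by (intro exI[of _ "insert (a, m a) M"]) simp
    qed
  qed
  then obtain M where "is_matching Q M" "(\<Sum>p\<in>Q. \<delta> p (m p)) = 2 * (\<Sum>(p,q)\<in>M. \<delta> p q)" by auto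
  then show ?thesis using opt_max_match_ge[OF assms(1), of M \<delta>] by simp
qed

text \<open>Injectivity is asked on the endpoints only: a matching survives even if \<open>f\<close>
  identifies other points of \<open>P\<close>.\<close>

lemma is_matching_map:
  assumes "is_matching P N" "inj_on f (fst ` N \<union> snd ` N)"
  shows "is_matching (f ` P) (map_prod f f ` N)"
    and "(\<Sum>(p,q)\<in>map_prod f f ` N. \<delta> p q) = (\<Sum>(p,q)\<in>N. \<delta> (f p) (f q))"
proof -
  have mem: "p \<in> fst ` N \<union> snd ` N" "q \<in> fst ` N \<union> snd ` N" if "(p,q) \<in> N" for p q
    using that by force+
  have inj: "inj_on (map_prod f f) N"
  proof (rule inj_onI)
    fix x y assume "x \<in> N" "y \<in> N" "map_prod f f x = map_prod f f y"
    then show "x = y" using assms(2) mem unfolding inj_on_def by (cases x; cases y) (metis map_prod_simp prod.inject)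
  qed
  have "fst ` map_prod f f ` N \<union> snd ` map_prod f f ` N = f ` (fst ` N \<union> snd ` N)"
    by (force simp: image_iff)
  then have "card (fst ` map_prod f f ` N \<union> snd ` map_prod f f ` N) = 2 * card (map_prod f f ` N)"
    using assms(1) card_image[OF assms(2)] card_image[OF inj] unfolding is_matching_def by metis
  moreover have "f q \<noteq> f p" if "(p,q) \<in> N" for p q
    using inj_onD[OF assms(2) _ mem(2,1)[OF that]] assms(1) that unfolding is_matching_def by auto
  ultimately show "is_matching (f ` P) (map_prod f f ` N)"
    using assms(1) unfolding is_matching_def by auto
  show "(\<Sum>(p,q)\<in>map_prod f f ` N. \<delta> p q) = (\<Sum>(p,q)\<in>N. \<delta> (f p) (f q))"
    by (subst sum.reindex[OF inj]) (auto simp: case_prod_unfold)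
qed

text \<open>Matchings of the image are images of the matchings that \<open>f\<close> does not collapse; the right-hand side
  ranges over a fixed finite set and is therefore measurable when \<open>f\<close> is random.\<close>
lemma opt_max_match_image:
  assumes "finite P"
  shows "opt_max_match \<delta> (f ` P) = Max ((\<lambda>N. if inj_on f (fst ` N \<union> snd ` N)
    then \<Sum>(p,q)\<in>N. \<delta> (f p) (f q) else 0) ` {N. is_matching P N})" (is "_ = Max (?g ` ?N)")
proof (rule antisym)
  obtain M where M: "is_matching (f ` P) M" "opt_max_match \<delta> (f ` P) = (\<Sum>(p,q)\<in>M. \<delta> p q)"
    using opt_max_match_attained[of "f ` P"] assms by blast
  \<comment> \<open>A section of \<open>f\<close> lifts an optimal matching of the image to a
    matching of \<open>P\<close> that \<open>f\<close> does not collapse.\<close>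
  define g where "g = inv_into P f"
  have fg: "f (g y) = y" "g y \<in> P" if "y \<in> f ` P" for y
    unfolding g_def using that by (auto simp: f_inv_into_f inv_into_into)
  have V: "fst ` M \<union> snd ` M \<subseteq> f ` P" using is_matching_ends(4)[OF M(1)] assms by auto
  have inj: "inj_on g (fst ` M \<union> snd ` M)" using fg V by (metis inj_on_def subsetD)
  let ?K = "map_prod g g ` M"
  have K: "is_matching (g ` f ` P) ?K" using is_matching_map(1)[OF M(1) inj] .
  have "g ` f ` P \<subseteq> P" using fg by auto
  then have KP: "is_matching P ?K" using K unfolding is_matching_def by blast
  have "fst ` ?K \<union> snd ` ?K = g ` (fst ` M \<union> snd ` M)" by (force simp: image_iff)
  moreover have "inj_on f (g ` (fst ` M \<union> snd ` M))"
    by (rule inj_on_inverseI[of _ g]) (use fg(1) V in \<open>metis imageE subsetD\<close>)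
  ultimately have injf: "inj_on f (fst ` ?K \<union> snd ` ?K)" by simp
  have "(\<Sum>(p,q)\<in>?K. \<delta> (f p) (f q)) = (\<Sum>(p,q)\<in>M. \<delta> (f (g p)) (f (g q)))"
    using is_matching_map(2)[OF M(1) inj] .
  also have "\<dots> = (\<Sum>(p,q)\<in>M. \<delta> p q)"
    using M(1) fg unfolding is_matching_def by (intro sum.cong) auto
  finally have "opt_max_match \<delta> (f ` P) = ?g ?K" using M(2) injf by simp
  then show "opt_max_match \<delta> (f ` P) \<le> Max (?g ` ?N)"
    using KP finite_matchings[OF assms] by (auto intro!: Max_ge)
  \<comment> \<open>Collapsed matchings get the value 0, which is harmless because the empty
    matching keeps the optimum nonnegative.\<close>
  have "?g N \<le> opt_max_match \<delta> (f ` P)" if "is_matching P N" for N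
  proof (cases "inj_on f (fst ` N \<union> snd ` N)")
    case True
    show ?thesis
      using opt_max_match_ge[OF _ is_matching_map(1)[OF that True], of \<delta>] is_matching_map(2)[OF that True, of \<delta>]
        True assms by simp
  next
    case False then show ?thesis using opt_max_match_nonneg[of "f ` P" \<delta>] assms by simp
  qed
  then show "Max (?g ` ?N) \<le> opt_max_match \<delta> (f ` P)"
    using finite_matchings[OF assms] is_matching_empty[of P]
    by (intro Max.boundedI finite_imageI) (auto simp only: image_is_empty mem_Collect_eq empty_iff)
qed

section \<open>Gaussian random maps\<close>

lemma prob_space_PiM_normal:
  assumes "0 < s"
  shows "prob_space (PiM I (\<lambda>_. density lborel (normal_density 0 s)))"
  using assms by (intro prob_space_PiM prob_space_normal_density)

text \<open>The joint law of the coordinates is the measure itself, which is the product of its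
  marginals.\<close>

lemma indep_vars_PiM_coordinates:
  assumes "I \<noteq> {}" "\<And>i. prob_space (N i)"
  shows "prob_space.indep_vars (PiM I N) N (\<lambda>i w. w i) I"
proof -
  interpret prob_space "PiM I N" using assms(2) by (intro prob_space_PiM)
  have "distr (PiM I N) (PiM I N) (\<lambda>x. \<lambda>i\<in>I. x i) = distr (PiM I N) (PiM I N) (\<lambda>x. x)"
    by (intro distr_cong) (auto simp: space_PiM PiE_restrict)
  also have "\<dots> = PiM I (\<lambda>i. distr (PiM I N) (N i) (\<lambda>w. w i))"
    unfolding distr_id2[OF refl] by (intro PiM_cong refl distr_PiM_component[symmetric] assms(2))
  finally show ?thesis using assms(1) by (subst indep_vars_iff_distr_eq_PiM') auto
qed

lemma distributed_PiM_normal_combination: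
  fixes c :: "'i \<Rightarrow> real"
  assumes s: "0 < s" and "finite I" and c: "(\<Sum>i\<in>I. (c i)\<^sup>2) \<noteq> 0"
  defines "N \<equiv> \<lambda>_. density lborel (normal_density 0 s)"
  shows "distributed (PiM I N) lborel (\<lambda>w. \<Sum>i\<in>I. w i * c i) (normal_density 0 (s * sqrt (\<Sum>i\<in>I. (c i)\<^sup>2)))"
proof -
  have Np: "prob_space (N i)" for i unfolding N_def using s by (rule prob_space_normal_density)
  interpret prob_space "PiM I N" using Np by (intro prob_space_PiM)
  \<comment> \<open>A zero coefficient gives a constant summand, which has no normal density, so
    such coordinates are dropped first.\<close>
  define J where "J = {i \<in> I. c i \<noteq> 0}"
  have J: "finite J" "J \<subseteq> I" unfolding J_def using assms by auto
  have "J \<noteq> {}" 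
  proof
    assume "J = {}"
    then have "(\<Sum>i\<in>I. (c i)\<^sup>2) = 0" unfolding J_def by (intro sum.neutral) auto
    then show False using c by simp
  qed
  have mN: "(\<lambda>x. x * c i) \<in> borel_measurable (N i)" for i unfolding N_def by simp
  have "indep_vars N (\<lambda>i w. w i) I" using \<open>J \<noteq> {}\<close> J Np by (intro indep_vars_PiM_coordinates) auto
  then have "indep_vars N (\<lambda>i w. w i) J" using J(2) by (rule indep_vars_subset)
  then have ind: "indep_vars (\<lambda>_. borel) (\<lambda>i w. w i * c i) J"
    by (rule indep_vars_compose2[where Y="\<lambda>i x. x * c i"]) (rule mN)
  have d: "distributed (PiM I N) lborel (\<lambda>w. w i * c i) (normal_density 0 (\<bar>c i\<bar> * s))" if "i \<in> J" for i
  proof -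
    have i: "i \<in> I" "c i \<noteq> 0" using that unfolding J_def by auto
    have "distr (PiM I N) lborel (\<lambda>w. w i) = distr (PiM I N) (N i) (\<lambda>w. w i)"
      by (intro distr_cong) (auto simp: N_def)
    also have "\<dots> = N i" using i Np by (intro distr_PiM_component)
    finally have "distributed (PiM I N) lborel (\<lambda>w. w i) (normal_density 0 s)"
      unfolding distributed_def using i by (auto simp: N_def)
    then have "distributed (PiM I N) lborel (\<lambda>w. 0 + c i * w i) (normal_density (0 + c i * 0) (\<bar>c i\<bar> * s))"
      using s i by (intro normal_density_affine) auto
    then show ?thesis by (simp add: mult.commute)
  qed
  have "distributed (PiM I N) lborel (\<lambda>w. \<Sum>i\<in>J. w i * c i)
      (normal_density (\<Sum>i\<in>J. 0) (sqrt (\<Sum>i\<in>J. (\<bar>c i\<bar> * s)\<^sup>2)))"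
    using s J \<open>J \<noteq> {}\<close> ind d by (intro sum_indep_normal) (auto simp: J_def)
  moreover have "(\<Sum>i\<in>J. w i * c i) = (\<Sum>i\<in>I. w i * c i)" for w
    using J assms by (intro sum.mono_neutral_left) (auto simp: J_def)
  moreover have "(\<Sum>i\<in>J. (\<bar>c i\<bar> * s)\<^sup>2) = s\<^sup>2 * (\<Sum>i\<in>I. (c i)\<^sup>2)"
  proof -
    have "(\<Sum>i\<in>J. (\<bar>c i\<bar> * s)\<^sup>2) = (\<Sum>i\<in>I. (\<bar>c i\<bar> * s)\<^sup>2)"
      using J assms by (intro sum.mono_neutral_left) (auto simp: J_def)
    then show ?thesis by (simp add: power_mult_distrib sum_distrib_left mult.commute)
  qed
  ultimately show ?thesis using s by (simp add: real_sqrt_mult)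
qed

section \<open>Moments of normal variables\<close>

context prob_space
begin

lemma normal_distributed_integrable_power:
  assumes "0 < \<sigma>" "distributed M lborel X (normal_density 0 \<sigma>)"
  shows "integrable M (\<lambda>w. X w ^ k)"
  using distributed_integrable[OF assms(2), of "\<lambda>x. x ^ k"] integrable_normal_moment[OF assms(1), of 0 k]
  by simp

lemma normal_distributed_moments:
  assumes "0 < \<sigma>" "distributed M lborel X (normal_density 0 \<sigma>)"
  shows "expectation (\<lambda>w. (X w)\<^sup>2) = \<sigma>\<^sup>2" "expectation (\<lambda>w. X w ^ 4) = 3 * \<sigma> ^ 4"
proof -
  show "expectation (\<lambda>w. (X w)\<^sup>2) = \<sigma>\<^sup>2"
    using distributed_integral[OF assms(2), of "\<lambda>x. x\<^sup>2"] integral_normal_moment_even[OF assms(1), of 0 1] by simp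
  show "expectation (\<lambda>w. X w ^ 4) = 3 * \<sigma> ^ 4"
    using distributed_integral[OF assms(2), of "\<lambda>x. x ^ 4"] integral_normal_moment_even[OF assms(1), of 0 2]
    by (simp add: fact_numeral power2_eq_square power4_eq_xxxx)
qed

lemma normal_distributed_abs:
  assumes "0 < \<sigma>" "distributed M lborel X (normal_density 0 \<sigma>)"
  shows "integrable M (\<lambda>w. \<bar>X w\<bar>)" "expectation (\<lambda>w. \<bar>X w\<bar>) = \<sigma> * sqrt (2 / pi)"
proof -
  show "integrable M (\<lambda>w. \<bar>X w\<bar>)"
    using normal_distributed_integrable_power[OF assms, of 1] by simp
  show "expectation (\<lambda>w. \<bar>X w\<bar>) = \<sigma> * sqrt (2 / pi)"
    using distributed_integral[OF assms(2), of "\<lambda>x. \<bar>x\<bar>"] integral_normal_moment_abs_odd[OF assms(1), of 0 0]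
    by simp
qed

lemma normal_distributed_nonzero:
  assumes "0 < \<sigma>" "distributed M lborel X (normal_density 0 \<sigma>)"
  shows "AE w in M. X w \<noteq> 0"
proof -
  have [measurable]: "X \<in> measurable M lborel" using assms(2) by (rule distributed_measurable)
  have "AE x in lborel. x \<noteq> (0::real)" by (rule AE_lborel_singleton)
  then have "AE x in distr M lborel X. x \<noteq> 0"
    unfolding distributed_distr_eq_density[OF assms(2)] by (subst AE_density) auto
  then show ?thesis by (subst (asm) AE_distr_iff[OF \<open>X \<in> measurable M lborel\<close>]) auto
qed

end

text \<open>Polarization yields the mixed moment from one-dimensional marginals, without an independence argument.\<close>
lemma (in prob_space) fourth_mixed_moment:
  assumes s: "0 < \<sigma>" "0 < \<tau>" "\<tau>\<^sup>2 = 2 * \<sigma>\<^sup>2"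
    and X: "distributed M lborel X (normal_density 0 \<sigma>)"
    and Y: "distributed M lborel Y (normal_density 0 \<sigma>)"
    and p: "distributed M lborel (\<lambda>w. X w + Y w) (normal_density 0 \<tau>)"
    and m: "distributed M lborel (\<lambda>w. X w - Y w) (normal_density 0 \<tau>)"
  shows "integrable M (\<lambda>w. (X w)\<^sup>2 * (Y w)\<^sup>2)" "expectation (\<lambda>w. (X w)\<^sup>2 * (Y w)\<^sup>2) = \<sigma> ^ 4"
proof -
  have polarization: "(X w)\<^sup>2 * (Y w)\<^sup>2 = ((X w + Y w) ^ 4 + (X w - Y w) ^ 4 - 2 * X w ^ 4 - 2 * Y w ^ 4) / 12" for w
    by (simp add: power4_eq_xxxx power2_eq_square algebra_simps)
  note i [simp] = normal_distributed_integrable_power[OF s(1) X, of 4] normal_distributed_integrable_power[OF s(1) Y, of 4]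
    normal_distributed_integrable_power[OF s(2) p, of 4] normal_distributed_integrable_power[OF s(2) m, of 4]
  show "integrable M (\<lambda>w. (X w)\<^sup>2 * (Y w)\<^sup>2)" unfolding polarization by simp
  have "\<tau> ^ 4 = (\<tau>\<^sup>2)\<^sup>2" by simp
  also have "\<dots> = 4 * \<sigma> ^ 4" unfolding s(3) by (simp add: power_mult_distrib)
  finally have t4: "\<tau> ^ 4 = 4 * \<sigma> ^ 4" .
  have "expectation (\<lambda>w. (X w)\<^sup>2 * (Y w)\<^sup>2) = (expectation (\<lambda>w. (X w + Y w) ^ 4) + expectation (\<lambda>w. (X w - Y w) ^ 4)
     - 2 * expectation (\<lambda>w. X w ^ 4) - 2 * expectation (\<lambda>w. Y w ^ 4)) / 12"
    unfolding polarization by simp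
  also have "\<dots> = \<sigma> ^ 4"
    unfolding normal_distributed_moments(2)[OF s(1) X] normal_distributed_moments(2)[OF s(1) Y]
      normal_distributed_moments(2)[OF s(2) p] normal_distributed_moments(2)[OF s(2) m] t4 by simp
  finally show "expectation (\<lambda>w. (X w)\<^sup>2 * (Y w)\<^sup>2) = \<sigma> ^ 4" .
qed

text \<open>The pointwise AM-GM bound of \<open>\<bar>z\<bar>\<close> by the mean of
  \<open>z\<^sup>2 / c\<close> and \<open>c\<close> replaces Cauchy-Schwarz and yields integrability
  at the same time.\<close>

lemma (in prob_space) expectation_abs_le_of_square:
  fixes Z :: "'a \<Rightarrow> real" and c :: real
  assumes [simp]: "integrable M (\<lambda>w. (Z w)\<^sup>2)" and [measurable]: "Z \<in> borel_measurable M"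
    and "expectation (\<lambda>w. (Z w)\<^sup>2) \<le> c\<^sup>2" "0 < c"
  shows "integrable M (\<lambda>w. \<bar>Z w\<bar>)" "expectation (\<lambda>w. \<bar>Z w\<bar>) \<le> c"
proof -
  have le: "\<bar>z\<bar> \<le> (z\<^sup>2 / c + c) / 2" for z :: real
  proof -
    have "0 \<le> (\<bar>z\<bar> - c)\<^sup>2" by simp
    then have "2 * \<bar>z\<bar> * c \<le> z\<^sup>2 + c\<^sup>2" by (simp add: power2_diff)
    then have "2 * \<bar>z\<bar> \<le> (z\<^sup>2 + c\<^sup>2) / c" using \<open>0 < c\<close> by (simp add: pos_le_divide_eq)
    then show ?thesis using \<open>0 < c\<close> by (simp add: add_divide_distrib power2_eq_square)
  qed
  have i: "integrable M (\<lambda>w. ((Z w)\<^sup>2 / c + c) / 2)" by simp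
  show a: "integrable M (\<lambda>w. \<bar>Z w\<bar>)"
  proof (rule Bochner_Integration.integrable_bound[OF i])
    show "AE w in M. norm \<bar>Z w\<bar> \<le> norm (((Z w)\<^sup>2 / c + c) / 2)"
      unfolding real_norm_def abs_abs by (intro AE_I2 order_trans[OF le abs_ge_self])
  qed measurable
  have "expectation (\<lambda>w. \<bar>Z w\<bar>) \<le> expectation (\<lambda>w. ((Z w)\<^sup>2 / c + c) / 2)"
    using le by (intro integral_mono a i)
  also have "\<dots> = (expectation (\<lambda>w. (Z w)\<^sup>2) / c + c) / 2" by (simp add: prob_space)
  also have "\<dots> \<le> (c\<^sup>2 / c + c) / 2" using assms by (intro divide_right_mono add_mono) auto
  also have "\<dots> = c" using assms by (simp add: power2_eq_square)
  finally show "expectation (\<lambda>w. \<bar>Z w\<bar>) \<le> c" .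
qed

text \<open>The row weights \<open>a\<close> cover a single row as well as the sums and differences
  of two rows needed for polarization. The coefficient of entry \<open>(i, j)\<close> is
  \<open>a i * v j\<close>, so the squared norms multiply.\<close>

lemma distributed_gaussian_JL_combination:
  assumes "0 < t" "(\<Sum>i<t. (a i)\<^sup>2) \<noteq> 0" "(\<Sum>j<d. (v j)\<^sup>2) \<noteq> 0"
  shows "distributed (gaussian_JL t d) lborel (\<lambda>G. \<Sum>i<t. a i * (\<Sum>j<d. G (i, j) * v j))
    (normal_density 0 (sqrt (1 / real t) * sqrt ((\<Sum>i<t. (a i)\<^sup>2) * (\<Sum>j<d. (v j)\<^sup>2))))"
proof -
  define c where "c = (\<lambda>(i, j). a i * v j)"
  have c: "(\<Sum>x\<in>{..<t} \<times> {..<d}. (c x)\<^sup>2) = (\<Sum>i<t. (a i)\<^sup>2) * (\<Sum>j<d. (v j)\<^sup>2)"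
    by (simp add: c_def sum_product sum.cartesian_product power_mult_distrib case_prod_unfold)
  have "distributed (gaussian_JL t d) lborel (\<lambda>G. \<Sum>x\<in>{..<t} \<times> {..<d}. G x * c x)
    (normal_density 0 (sqrt (1 / real t) * sqrt (\<Sum>x\<in>{..<t} \<times> {..<d}. (c x)\<^sup>2)))"
    unfolding gaussian_JL_def
    by (rule distributed_PiM_normal_combination) (use assms c in auto)
  moreover have "(\<Sum>x\<in>{..<t} \<times> {..<d}. G x * c x) = (\<Sum>i<t. a i * (\<Sum>j<d. G (i, j) * v j))" for G
    by (simp add: c_def sum_distrib_left sum.cartesian_product case_prod_unfold algebra_simps)
  ultimately show ?thesis unfolding c by simp
qed

section \<open>Distortion of one vector by the Gaussian matrix\<close>

lemma prob_space_gaussian_JL: "0 < t \<Longrightarrow> prob_space (gaussian_JL t d)"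
  unfolding gaussian_JL_def by (intro prob_space_PiM_normal) simp

lemma gaussian_JL_row_distributed:
  assumes "i < t" "(\<Sum>j<d. (v j)\<^sup>2) \<noteq> 0"
  shows "distributed (gaussian_JL t d) lborel (\<lambda>G. \<Sum>j<d. G (i, j) * v j)
    (normal_density 0 (sqrt ((\<Sum>j<d. (v j)\<^sup>2) / real t)))"
  using distributed_gaussian_JL_combination[of t "\<lambda>k. of_bool (k = i)" v d] assms
  by (simp add: power2_eq_square of_bool_def if_distrib[of "\<lambda>x. x * _"] cong: if_cong flip: real_sqrt_mult)

text \<open>The centred squares of the \<open>t\<close> row values are uncorrelated, and each has
  variance \<open>2 * \<sigma> ^ 4\<close>, where \<open>\<sigma>\<^sup>2\<close> is the squared
  length of \<open>v\<close> divided by \<open>t\<close>.\<close>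

lemma gaussian_JL_square_norm_variance:
  fixes v :: "nat \<Rightarrow> real" and t d :: nat
  assumes t: "0 < t" and v: "(\<Sum>j<d. (v j)\<^sup>2) \<noteq> 0"
  defines "Y \<equiv> \<lambda>i G. \<Sum>j<d. G (i :: nat, j) * v j"
  defines "Z \<equiv> \<lambda>G. (\<Sum>i<t. (Y i G)\<^sup>2) - (\<Sum>j<d. (v j)\<^sup>2)"
  shows "integrable (gaussian_JL t d) (\<lambda>G. (Z G)\<^sup>2)"
    and "(\<integral>G. (Z G)\<^sup>2 \<partial>gaussian_JL t d) = 2 * (\<Sum>j<d. (v j)\<^sup>2)\<^sup>2 / real t"
proof -
  interpret prob_space "gaussian_JL t d" using t by (rule prob_space_gaussian_JL)
  let ?M = "gaussian_JL t d"
  define n where "n = (\<Sum>j<d. (v j)\<^sup>2)"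
  have n: "n > 0" using v unfolding n_def by (simp add: less_le sum_nonneg)
  define \<sigma> where "\<sigma> = sqrt (n / real t)"
  have s: "\<sigma> > 0" "\<sigma>\<^sup>2 = n / real t" using n t unfolding \<sigma>_def by auto
  have D: "distributed ?M lborel (Y i) (normal_density 0 \<sigma>)" if "i < t" for i
    using gaussian_JL_row_distributed[OF that v] unfolding Y_def \<sigma>_def n_def .
  define \<tau> where "\<tau> = sqrt (1 / real t) * sqrt (2 * n)"
  have ts: "\<tau> > 0" "\<tau>\<^sup>2 = 2 * \<sigma>\<^sup>2" using n t unfolding \<tau>_def s(2) by (auto simp: power_mult_distrib)
  \<comment> \<open>The values 1 and -1 of \<open>e\<close> give the sum and the difference of two
    rows.\<close>
  have D2: "distributed ?M lborel (\<lambda>G. Y i G + e * Y k G) (normal_density 0 \<tau>)"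
    if "i < t" "k < t" "i \<noteq> k" "e\<^sup>2 = 1" for i k e
  proof -
    define a where "a = (\<lambda>l. if l = i then 1 else if l = k then e else 0)"
    have sa: "(\<Sum>l<t. a l * f l) = f i + e * f k" for f
    proof -
      have "(\<Sum>l<t. a l * f l) = (\<Sum>l\<in>{i, k}. a l * f l)"
        using that by (intro sum.mono_neutral_right) (auto simp: a_def)
      then show ?thesis using that by (auto simp: a_def)
    qed
    have "(\<Sum>l<t. (a l)\<^sup>2) = 2"
      using sa[of a] that by (auto simp: power2_eq_square a_def)
    then show ?thesis
      using distributed_gaussian_JL_combination[OF t _ v, of a] unfolding sa \<tau>_def n_def Y_def by simp
  qed
  define W where "W = (\<lambda>i k G. ((Y i G)\<^sup>2 - \<sigma>\<^sup>2) * ((Y k G)\<^sup>2 - \<sigma>\<^sup>2))"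
  have Wx: "W i k G = (Y i G)\<^sup>2 * (Y k G)\<^sup>2 - \<sigma>\<^sup>2 * (Y i G)\<^sup>2 - \<sigma>\<^sup>2 * (Y k G)\<^sup>2 + \<sigma>\<^sup>2 * \<sigma>\<^sup>2" for i k G
    unfolding W_def by (simp add: algebra_simps)
  have W: "integrable ?M (W i k) \<and> expectation (W i k) = (if i = k then 2 * \<sigma> ^ 4 else 0)"
    if ik: "i < t" "k < t" for i k
  proof -
    have i2 [simp]: "integrable ?M (\<lambda>G. (Y l G)\<^sup>2)" "expectation (\<lambda>G. (Y l G)\<^sup>2) = \<sigma>\<^sup>2" if "l < t" for l
      using normal_distributed_integrable_power[OF s(1) D[OF that], of 2]
        normal_distributed_moments(1)[OF s(1) D[OF that]] by auto
    have "integrable ?M (\<lambda>G. (Y i G)\<^sup>2 * (Y k G)\<^sup>2) \<and>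
        expectation (\<lambda>G. (Y i G)\<^sup>2 * (Y k G)\<^sup>2) = (if i = k then 3 * \<sigma> ^ 4 else \<sigma> ^ 4)"
    proof (cases "i = k")
      case True
      have "(Y i G)\<^sup>2 * (Y k G)\<^sup>2 = Y i G ^ 4" for G unfolding True by (simp flip: power_add)
      then show ?thesis using True normal_distributed_integrable_power[OF s(1) D[OF ik(1)], of 4]
        normal_distributed_moments(2)[OF s(1) D[OF ik(1)]] by simp
    next
      case False
      show ?thesis
        using fourth_mixed_moment[OF s(1) ts D[OF ik(1)] D[OF ik(2)]] D2[OF ik False, of 1] D2[OF ik False, of "-1"] False
        by simp
    qed
    then have p: "integrable ?M (\<lambda>G. (Y i G)\<^sup>2 * (Y k G)\<^sup>2)"
      "expectation (\<lambda>G. (Y i G)\<^sup>2 * (Y k G)\<^sup>2) = (if i = k then 3 * \<sigma> ^ 4 else \<sigma> ^ 4)" by auto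
    have "expectation (W i k) = expectation (\<lambda>G. (Y i G)\<^sup>2 * (Y k G)\<^sup>2) - \<sigma>\<^sup>2 * \<sigma>\<^sup>2 - \<sigma>\<^sup>2 * \<sigma>\<^sup>2 + \<sigma>\<^sup>2 * \<sigma>\<^sup>2"
      unfolding Wx using p(1) i2 ik by (simp add: prob_space)
    also have "\<dots> = (if i = k then 2 * \<sigma> ^ 4 else 0)" unfolding p(2) by (simp flip: power_add)
    finally show ?thesis using p(1) i2 ik unfolding Wx by simp
  qed
  have "(\<Sum>i<t. (Y i G)\<^sup>2) - n = (\<Sum>i<t. (Y i G)\<^sup>2 - \<sigma>\<^sup>2)" for G
    using t s by (simp add: sum_subtractf)
  then have Z2: "(Z G)\<^sup>2 = (\<Sum>i<t. \<Sum>k<t. W i k G)" for G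
    unfolding Z_def n_def[symmetric] W_def by (simp add: power2_eq_square sum_product)
  show "integrable ?M (\<lambda>G. (Z G)\<^sup>2)" unfolding Z2 using W by (intro Bochner_Integration.integrable_sum) auto
  have "expectation (\<lambda>G. (Z G)\<^sup>2) = (\<Sum>i<t. \<Sum>k<t. expectation (W i k))"
    unfolding Z2 using W by (subst Bochner_Integration.integral_sum; force intro!: Bochner_Integration.integral_sum)
  also have "\<dots> = (\<Sum>i<t. 2 * \<sigma> ^ 4)" using W by (intro sum.cong) (auto simp: sum.delta)
  also have "\<dots> = real t * (2 * (\<sigma>\<^sup>2)\<^sup>2)" by (simp flip: power_mult)
  also have "\<dots> = 2 * n\<^sup>2 / real t" unfolding s(2) using t by (simp add: power2_eq_square field_simps)
  finally show "expectation (\<lambda>G. (Z G)\<^sup>2) = 2 * (\<Sum>j<d. (v j)\<^sup>2)\<^sup>2 / real t" unfolding n_def .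
qed

text \<open>For \<open>n > 0\<close> the deviation of the length from \<open>n\<close> is at most
  the deviation of the squared length divided by \<open>n\<close>, because the factor
  \<open>R G + n\<close> is at least \<open>n\<close>.\<close>

lemma gaussian_JL_norm_deviation:
  fixes v :: "nat \<Rightarrow> real" and t d :: nat
  assumes t: "0 < t"
  defines "R \<equiv> \<lambda>G. eucl_norm t (\<lambda>i. \<Sum>j<d. G (i, j) * v j)"
  shows "integrable (gaussian_JL t d) (\<lambda>G. \<bar>R G - eucl_norm d v\<bar>)"
    and "(\<integral>G. \<bar>R G - eucl_norm d v\<bar> \<partial>gaussian_JL t d) \<le> sqrt (2 / real t) * eucl_norm d v"
proof -
  interpret prob_space "gaussian_JL t d" using t by (rule prob_space_gaussian_JL)
  let ?M = "gaussian_JL t d"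
  have mR [measurable]: "R \<in> borel_measurable ?M"
    unfolding R_def eucl_norm_def gaussian_JL_def by measurable
  have goal: "integrable ?M (\<lambda>G. \<bar>R G - eucl_norm d v\<bar>) \<and>
    expectation (\<lambda>G. \<bar>R G - eucl_norm d v\<bar>) \<le> sqrt (2 / real t) * eucl_norm d v"
  proof (cases "(\<Sum>j<d. (v j)\<^sup>2) = 0")
    case True
    then have "v j = 0" if "j < d" for j using that by (simp add: sum_nonneg_eq_0_iff)
    then have "R G = 0" "eucl_norm d v = 0" for G unfolding R_def eucl_norm_def by simp_all
    then show ?thesis by simp
  next
    case False
    define n where "n = eucl_norm d v"
    define Z where "Z = (\<lambda>G. (\<Sum>i<t. (\<Sum>j<d. G (i :: nat, j) * v j)\<^sup>2) - (\<Sum>j<d. (v j)\<^sup>2))"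
    have n: "n > 0" "n\<^sup>2 = (\<Sum>j<d. (v j)\<^sup>2)"
      using False unfolding n_def eucl_norm_def by (auto simp: less_le sum_nonneg)
    have mZ [measurable]: "Z \<in> borel_measurable ?M"
      unfolding Z_def gaussian_JL_def by measurable
    have ZR: "Z G = (R G)\<^sup>2 - n\<^sup>2" for G
      unfolding Z_def n(2) R_def eucl_norm_def by (simp add: sum_nonneg)
    have R0: "R G \<ge> 0" for G unfolding R_def eucl_norm_def by (simp add: sum_nonneg)
    have dev: "\<bar>R G - n\<bar> \<le> \<bar>Z G\<bar> / n" for G
    proof -
      have "\<bar>R G - n\<bar> * n \<le> \<bar>R G - n\<bar> * \<bar>R G + n\<bar>" using R0[of G] n by (intro mult_left_mono) auto
      also have "\<dots> = \<bar>Z G\<bar>" unfolding ZR abs_mult[symmetric] by (simp add: power2_eq_square algebra_simps)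
      finally show ?thesis using n by (simp add: pos_le_divide_eq)
    qed
    have c: "0 < sqrt (2 / real t) * n\<^sup>2" using t n(1) by simp
    have v: "expectation (\<lambda>G. (Z G)\<^sup>2) \<le> (sqrt (2 / real t) * n\<^sup>2)\<^sup>2"
      using gaussian_JL_square_norm_variance(2)[OF t False] unfolding Z_def n(2) by (simp add: power_mult_distrib)
    have iZ: "integrable ?M (\<lambda>G. (Z G)\<^sup>2)"
      using gaussian_JL_square_norm_variance(1)[OF t False] unfolding Z_def .
    note e = expectation_abs_le_of_square[OF iZ mZ v c]
    have i2: "integrable ?M (\<lambda>G. \<bar>Z G\<bar> / n)" using e(1) by simp
    have i: "integrable ?M (\<lambda>G. \<bar>R G - n\<bar>)"
      by (rule Bochner_Integration.integrable_bound[OF i2]) (use dev n in \<open>auto intro!: AE_I2\<close>)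
    have "expectation (\<lambda>G. \<bar>R G - n\<bar>) \<le> expectation (\<lambda>G. \<bar>Z G\<bar> / n)"
      using dev by (intro integral_mono i i2)
    also have "\<dots> \<le> (sqrt (2 / real t) * n\<^sup>2) / n" using e(2) n by (simp add: divide_right_mono)
    also have "\<dots> = sqrt (2 / real t) * n" using n(1) by (simp add: power2_eq_square)
    finally show ?thesis using i unfolding n_def by simp
  qed
  then show "integrable ?M (\<lambda>G. \<bar>R G - eucl_norm d v\<bar>)"
    "expectation (\<lambda>G. \<bar>R G - eucl_norm d v\<bar>) \<le> sqrt (2 / real t) * eucl_norm d v" by auto
qed

section \<open>Images of a point set under random linear maps\<close>

lemma eucl_dist_eq_L2_set: "eucl_dist d x y = L2_set (\<lambda>i. x i - y i) {..<d}"
  unfolding eucl_dist_def eucl_norm_def L2_set_def ..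

lemma eucl_dist_nonneg [simp]: "0 \<le> eucl_dist d x y"
  unfolding eucl_dist_eq_L2_set by simp

lemma eucl_dist_commute: "eucl_dist d x y = eucl_dist d y x"
  unfolding eucl_dist_def eucl_norm_def by (simp add: power2_commute)

lemma eucl_dist_power2: "(eucl_dist d x y)\<^sup>2 = (\<Sum>i<d. (x i - y i)\<^sup>2)"
  unfolding eucl_dist_def eucl_norm_def by (simp add: sum_nonneg)

lemma eucl_dist_triangle: "eucl_dist d p q \<le> eucl_dist d p z + eucl_dist d q z"
proof -
  have "eucl_dist d p q = L2_set (\<lambda>i. (p i - z i) + (z i - q i)) {..<d}"
    unfolding eucl_dist_eq_L2_set by simp
  also have "\<dots> \<le> eucl_dist d p z + eucl_dist d z q"
    unfolding eucl_dist_eq_L2_set by (rule L2_set_triangle_ineq)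
  finally show ?thesis by (simp add: eucl_dist_commute)
qed

text \<open>The distance sees only the first \<open>d\<close> coordinates; extensionality fixes the
  others.\<close>

lemma eucl_dist_eq_0_iff:
  assumes "p \<in> {..<d} \<rightarrow>\<^sub>E UNIV" "q \<in> {..<d} \<rightarrow>\<^sub>E UNIV"
  shows "eucl_dist d p q = 0 \<longleftrightarrow> p = q"
proof -
  have "eucl_dist d p q = 0 \<longleftrightarrow> (\<forall>i<d. p i = q i)"
    unfolding eucl_dist_eq_L2_set by (auto simp: L2_set_eq_0_iff)
  also have "\<dots> \<longleftrightarrow> p = q" using assms by (auto intro: PiE_ext)
  finally show ?thesis .
qed

text \<open>If the angle at \<open>z\<close> is at least a right angle, the law of cosines bounds
  \<open>a\<^sup>2 + b\<^sup>2\<close> by the squared distance of the pair, where \<open>a\<close>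
  and \<open>b\<close> are the distances to \<open>z\<close>; moreover
  \<open>(a + b)\<^sup>2\<close> is at most \<open>2 * (a\<^sup>2 + b\<^sup>2)\<close>.\<close>

lemma star_le_sqrt2_opt:
  assumes "finite P" "even (card P)"
  obtains z where "(\<Sum>p\<in>P. eucl_dist d p z) \<le> sqrt 2 * opt_max_match (eucl_dist d) P"
proof -
  have "\<exists>m z. fpf_involution_on P m \<and> (\<forall>p\<in>P. shifted_inner d z p (m p) \<le> 0)"
    by (rule diametral_balls_intersect[OF assms, of d]) auto
  then obtain m z where m: "fpf_involution_on P m" and z: "\<And>p. p \<in> P \<Longrightarrow> shifted_inner d z p (m p) \<le> 0"
    by auto
  have le: "eucl_dist d p z + eucl_dist d (m p) z \<le> sqrt 2 * eucl_dist d p (m p)" if "p \<in> P" for p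
  proof (rule power2_le_imp_le)
    let ?a = "eucl_dist d p z" and ?b = "eucl_dist d (m p) z"
    have "(eucl_dist d p (m p))\<^sup>2 = ?a\<^sup>2 + ?b\<^sup>2 - 2 * shifted_inner d z p (m p)"
      unfolding eucl_dist_power2 shifted_inner_def sum_distrib_left sum.distrib[symmetric] sum_subtractf[symmetric]
      by (intro sum.cong) (auto simp: power2_eq_square algebra_simps)
    then have "?a\<^sup>2 + ?b\<^sup>2 \<le> (eucl_dist d p (m p))\<^sup>2" using z[OF that] by simp
    moreover have "(?a + ?b)\<^sup>2 \<le> 2 * (?a\<^sup>2 + ?b\<^sup>2)"
      using sum_squares_bound[of ?a ?b] unfolding power2_sum by simp
    ultimately have "(?a + ?b)\<^sup>2 \<le> 2 * (eucl_dist d p (m p))\<^sup>2" by simp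
    then show "(?a + ?b)\<^sup>2 \<le> (sqrt 2 * eucl_dist d p (m p))\<^sup>2" by (simp add: power_mult_distrib)
  qed simp
  have "2 * (\<Sum>p\<in>P. eucl_dist d p z) = (\<Sum>p\<in>P. eucl_dist d p z + eucl_dist d (m p) z)"
    unfolding sum.distrib using sum_involution[OF m, of "\<lambda>p. eucl_dist d p z"] by simp
  also have "\<dots> \<le> (\<Sum>p\<in>P. sqrt 2 * eucl_dist d p (m p))" by (intro sum_mono le)
  also have "\<dots> = sqrt 2 * (\<Sum>p\<in>P. eucl_dist d p (m p))" by (simp add: sum_distrib_left)
  also have "\<dots> \<le> sqrt 2 * (2 * opt_max_match (eucl_dist d) P)"
    using assms m by (intro mult_left_mono fpf_involution_sum_le_opt eucl_dist_commute) auto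
  finally show ?thesis using that by simp
qed

lemma opt_max_match_image_ge:
  assumes "finite P" "is_matching P N" "inj_on f P"
  shows "(\<Sum>(p,q)\<in>N. \<delta> (f p) (f q)) \<le> opt_max_match \<delta> (f ` P)"
proof -
  have "inj_on f (fst ` N \<union> snd ` N)"
    using assms(3) is_matching_ends(4)[OF assms(2,1)] by (rule inj_on_subset)
  note m = is_matching_map[OF assms(2) this]
  show ?thesis using opt_max_match_ge[OF _ m(1), of \<delta>] m(2)[of \<delta>] assms(1) by simp
qed

text \<open>Identified points are counted once in the star of the image but repeatedly on the right,
  so the upper bound holds for every \<open>f\<close>, injective or not.\<close>

lemma opt_max_match_image_le_star:
  fixes h :: "'b \<Rightarrow> real"
  assumes "finite P" "\<And>p q. \<lbrakk>p \<in> P; q \<in> P\<rbrakk> \<Longrightarrow> \<delta> (f p) (f q) \<le> h (f p) + h (f q)"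
    "\<And>p. p \<in> P \<Longrightarrow> 0 \<le> h (f p)"
  shows "opt_max_match \<delta> (f ` P) \<le> (\<Sum>p\<in>P. h (f p))"
proof -
  have "opt_max_match \<delta> (f ` P) \<le> sum h (f ` P)"
    using assms by (intro opt_max_match_le_star) auto
  also have "\<dots> \<le> sum (h \<circ> f) P" using assms by (intro sum_image_le) auto
  finally show ?thesis by (simp add: comp_def)
qed

text \<open>By \<open>eq\<close>, injectivity on the endpoints is a finite conjunction of conditions
  on when the real random variables \<open>\<delta> (f w p) (f w q)\<close> vanish.\<close>

lemma borel_measurable_opt_max_match_image:
  assumes P: "finite P"
    and m: "\<And>p q. \<lbrakk>p \<in> P; q \<in> P\<rbrakk> \<Longrightarrow> (\<lambda>w. \<delta> (f w p) (f w q)) \<in> borel_measurable M"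
    and eq: "\<And>w p q. \<lbrakk>w \<in> space M; p \<in> P; q \<in> P\<rbrakk> \<Longrightarrow> \<delta> (f w p) (f w q) = 0 \<longleftrightarrow> f w p = f w q"
  shows "(\<lambda>w. opt_max_match \<delta> (f w ` P)) \<in> borel_measurable M"
  unfolding opt_max_match_image[OF P]
proof (rule borel_measurable_Max[OF finite_matchings[OF P]])
  fix N assume "N \<in> {N. is_matching P N}"
  then have N: "is_matching P N" by simp
  define V where "V = fst ` N \<union> snd ` N"
  have V: "V \<subseteq> P" unfolding V_def using is_matching_ends(4)[OF N P] .
  have "finite V" using V P by (rule finite_subset)
  have NV: "p \<in> P" "q \<in> P" if "(p, q) \<in> N" for p q using N that unfolding is_matching_def by auto
  have "(\<lambda>w. if \<forall>p\<in>V. \<forall>q\<in>V. \<delta> (f w p) (f w q) = 0 \<longrightarrow> p = q then \<Sum>x\<in>N. \<delta> (f w (fst x)) (f w (snd x)) else 0)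
      \<in> borel_measurable M"
  proof (rule measurable_If)
    show "(\<lambda>w. \<Sum>x\<in>N. \<delta> (f w (fst x)) (f w (snd x))) \<in> borel_measurable M"
      using NV by (intro borel_measurable_sum m) auto
    have "Measurable.pred M (\<lambda>w. \<delta> (f w p) (f w q) = 0 \<longrightarrow> p = q)" if "p \<in> V" "q \<in> V" for p q
    proof -
      have [measurable]: "(\<lambda>w. \<delta> (f w p) (f w q)) \<in> borel_measurable M" using that V by (intro m) auto
      show ?thesis by measurable
    qed
    then have "Measurable.pred M (\<lambda>w. \<forall>p\<in>V. \<forall>q\<in>V. \<delta> (f w p) (f w q) = 0 \<longrightarrow> p = q)"
      using \<open>finite V\<close> by (intro pred_intros_finite) auto
    then show "{w \<in> space M. \<forall>p\<in>V. \<forall>q\<in>V. \<delta> (f w p) (f w q) = 0 \<longrightarrow> p = q} \<in> sets M"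
      by (rule predE)
  qed simp
  moreover have "inj_on (f w) V \<longleftrightarrow> (\<forall>p\<in>V. \<forall>q\<in>V. \<delta> (f w p) (f w q) = 0 \<longrightarrow> p = q)" if "w \<in> space M" for w
    unfolding inj_on_def using eq[OF that] V by (metis subsetD)
  ultimately show "(\<lambda>w. if inj_on (f w) (fst ` N \<union> snd ` N) then \<Sum>(p,q)\<in>N. \<delta> (f w p) (f w q) else 0)
      \<in> borel_measurable M"
    unfolding V_def[symmetric] case_prod_unfold by (subst measurable_cong) auto
qed

section \<open>The random linear form\<close>

lemma lin_form_expectation:
  shows "integrable (gamma_space d) (\<lambda>w. \<bar>lin_form d w p - lin_form d w z\<bar>)"
    and "(\<integral>w. \<bar>lin_form d w p - lin_form d w z\<bar> \<partial>gamma_space d) = eucl_dist d p z"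
    and "eucl_dist d p z \<noteq> 0 \<Longrightarrow> AE w in gamma_space d. lin_form d w p \<noteq> lin_form d w z"
proof -
  interpret prob_space "gamma_space d" unfolding gamma_space_def by (rule prob_space_PiM_normal) simp
  let ?X = "\<lambda>w. \<Sum>j<d. w j * (p j - z j)"
  have X: "lin_form d w p - lin_form d w z = ?X w" for w
    unfolding lin_form_def by (simp add: sum_subtractf algebra_simps)
  have "integrable (gamma_space d) (\<lambda>w. \<bar>?X w\<bar>) \<and> expectation (\<lambda>w. \<bar>?X w\<bar>) = eucl_dist d p z \<and>
      (eucl_dist d p z \<noteq> 0 \<longrightarrow> (AE w in gamma_space d. ?X w \<noteq> 0))"
  proof (cases "eucl_dist d p z = 0")
    case True
    then have "?X w = 0" for w unfolding eucl_dist_eq_L2_set by (simp add: L2_set_eq_0_iff)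
    then show ?thesis using True by simp
  next
    case False
    have nz: "(\<Sum>j<d. (p j - z j)\<^sup>2) \<noteq> 0" using False by (simp flip: eucl_dist_power2)
    have n: "sqrt (\<Sum>j<d. (p j - z j)\<^sup>2) = eucl_dist d p z" unfolding eucl_dist_def eucl_norm_def ..
    have D: "distributed (gamma_space d) lborel ?X (normal_density 0 (sqrt (pi / 2) * eucl_dist d p z))"
      unfolding gamma_space_def n[symmetric] by (rule distributed_PiM_normal_combination) (use nz in auto)
    have pos: "sqrt (pi / 2) * eucl_dist d p z > 0" using False by (simp add: less_le)
    \<comment> \<open>The variance \<open>pi / 2\<close> compensates the factor
      \<open>sqrt (2 / pi)\<close> in the mean absolute value of a centred normal variable.\<close>
    have "sqrt (pi / 2) * sqrt (2 / pi) = 1" by (simp flip: real_sqrt_mult)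
    then show ?thesis
      using normal_distributed_abs[OF pos D] normal_distributed_nonzero[OF pos D] by (simp add: mult.commute mult.left_commute)
  qed
  then show "integrable (gamma_space d) (\<lambda>w. \<bar>lin_form d w p - lin_form d w z\<bar>)"
    "(\<integral>w. \<bar>lin_form d w p - lin_form d w z\<bar> \<partial>gamma_space d) = eucl_dist d p z"
    "eucl_dist d p z \<noteq> 0 \<Longrightarrow> AE w in gamma_space d. lin_form d w p \<noteq> lin_form d w z"
    unfolding X[symmetric] by auto
qed

lemma AE_inj_on_finite:
  assumes "finite P" "\<And>p q. \<lbrakk>p \<in> P; q \<in> P; p \<noteq> q\<rbrakk> \<Longrightarrow> AE w in M. f w p \<noteq> f w q"
  shows "AE w in M. inj_on (f w) P"
proof -
  have "AE w in M. \<forall>p\<in>P. \<forall>q\<in>P. p \<noteq> q \<longrightarrow> f w p \<noteq> f w q"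
    using assms by (intro AE_finite_allI) (auto intro: AE_I2)
  then show ?thesis by eventually_elim (auto simp: inj_on_def)
qed

lemma expected_opt_lin_form:
  fixes P :: "(nat \<Rightarrow> real) set"
  assumes P: "finite P" "P \<subseteq> {..<d} \<rightarrow>\<^sub>E UNIV" "even (card P)"
  defines "E \<equiv> \<integral>w. opt_max_match (\<lambda>a b. \<bar>a - b\<bar>) (lin_form d w ` P) \<partial>gamma_space d"
  shows "opt_max_match (eucl_dist d) P \<le> E" "E \<le> sqrt 2 * opt_max_match (eucl_dist d) P"
proof -
  interpret prob_space "gamma_space d" unfolding gamma_space_def by (rule prob_space_PiM_normal) simp
  let ?O = "\<lambda>w. opt_max_match (\<lambda>a b. \<bar>a - b\<bar>) (lin_form d w ` P)"
  have "(\<lambda>w. lin_form d w p) \<in> borel_measurable (gamma_space d)" for p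
    unfolding lin_form_def gamma_space_def by measurable
  then have meas: "?O \<in> borel_measurable (gamma_space d)"
    using P(1) by (intro borel_measurable_opt_max_match_image) auto
  obtain z where z: "(\<Sum>p\<in>P. eucl_dist d p z) \<le> sqrt 2 * opt_max_match (eucl_dist d) P"
    by (rule star_le_sqrt2_opt[OF P(1,3)])
  let ?U = "\<lambda>w. \<Sum>p\<in>P. \<bar>lin_form d w p - lin_form d w z\<bar>"
  have U: "integrable (gamma_space d) ?U" "expectation ?U = (\<Sum>p\<in>P. eucl_dist d p z)"
    using lin_form_expectation[of d] by (simp_all add: Bochner_Integration.integral_sum)
  have OU: "?O w \<le> ?U w" for w
    by (rule opt_max_match_image_le_star[OF P(1), where h="\<lambda>x. \<bar>x - lin_form d w z\<bar>"]) auto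
  have O0: "0 \<le> ?O w" for w using P(1) by (intro opt_max_match_nonneg) auto
  have O: "integrable (gamma_space d) ?O"
    by (rule Bochner_Integration.integrable_bound[OF U(1) meas])
      (intro AE_I2, use O0 OU in \<open>simp add: order_trans[OF OU abs_ge_self]\<close>)
  have "E \<le> expectation ?U" unfolding E_def using OU by (intro integral_mono O U)
  then show "E \<le> sqrt 2 * opt_max_match (eucl_dist d) P" using z U(2) by simp
  obtain N where N: "is_matching P N" "opt_max_match (eucl_dist d) P = (\<Sum>(p,q)\<in>N. eucl_dist d p q)"
    by (rule opt_max_match_attained[OF P(1)])
  let ?L = "\<lambda>w. \<Sum>(p,q)\<in>N. \<bar>lin_form d w p - lin_form d w q\<bar>"
  have L: "integrable (gamma_space d) ?L" "expectation ?L = opt_max_match (eucl_dist d) P"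
    unfolding N(2) case_prod_unfold using lin_form_expectation[of d] by (simp_all add: Bochner_Integration.integral_sum)
  have "AE w in gamma_space d. inj_on (lin_form d w) P"
    using P(2) by (intro AE_inj_on_finite P(1) lin_form_expectation(3)) (auto simp: eucl_dist_eq_0_iff subset_iff)
  then have "AE w in gamma_space d. ?L w \<le> ?O w"
  proof eventually_elim
    case (elim w)
    show ?case using opt_max_match_image_ge[OF P(1) N(1) elim, of "\<lambda>a b. \<bar>a - b\<bar>"] .
  qed
  then have "expectation ?L \<le> E" unfolding E_def by (intro integral_mono_AE L O)
  then show "opt_max_match (eucl_dist d) P \<le> E" using L by simp
qed

section \<open>The random matrix\<close>

lemma eucl_dist_apply_matrix:
  "eucl_dist t (apply_matrix t d G p) (apply_matrix t d G q)
    = eucl_norm t (\<lambda>i. \<Sum>j<d. G (i, j) * (p j - q j))"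
  unfolding eucl_dist_def eucl_norm_def apply_matrix_def
  by (simp add: right_diff_distrib sum_subtractf)

text \<open>The first row alone already separates two distinct points almost surely.\<close>

lemma AE_apply_matrix_neq:
  assumes "0 < t" "eucl_dist d p q \<noteq> 0"
  shows "AE G in gaussian_JL t d. apply_matrix t d G p \<noteq> apply_matrix t d G q"
proof -
  interpret prob_space "gaussian_JL t d" using assms(1) by (rule prob_space_gaussian_JL)
  have nz: "(\<Sum>j<d. (p j - q j)\<^sup>2) \<noteq> 0" using assms(2) by (simp flip: eucl_dist_power2)
  then have "0 < (\<Sum>j<d. (p j - q j)\<^sup>2)" by (simp add: less_le sum_nonneg)
  then have "sqrt ((\<Sum>j<d. (p j - q j)\<^sup>2) / real t) > 0" using assms(1) by simp
  from normal_distributed_nonzero[OF this gaussian_JL_row_distributed[OF assms(1) nz]]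
  show ?thesis
  proof eventually_elim
    case (elim G)
    then have "(\<Sum>j<d. G (0, j) * p j) \<noteq> (\<Sum>j<d. G (0, j) * q j)"
      by (simp add: right_diff_distrib sum_subtractf)
    then have "apply_matrix t d G p 0 \<noteq> apply_matrix t d G q 0"
      using assms(1) unfolding apply_matrix_def by simp
    then show ?case by auto
  qed
qed

lemma gaussian_JL_opt_approximation:
  fixes P :: "(nat \<Rightarrow> real) set"
  assumes P: "finite P" "P \<subseteq> {..<d} \<rightarrow>\<^sub>E UNIV" "even (card P)" and opt: "0 < opt_max_match (eucl_dist d) P"
    and \<epsilon>: "0 < \<epsilon>" "\<epsilon> < 1" and t: "288 / \<epsilon>\<^sup>2 \<le> real t"
  shows "measure (gaussian_JL t d)
           {G \<in> space (gaussian_JL t d).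
              opt_max_match (eucl_dist d) P / (1 + \<epsilon>)
                \<le> opt_max_match (eucl_dist t) (apply_matrix t d G ` P)
              \<and> opt_max_match (eucl_dist t) (apply_matrix t d G ` P)
                \<le> (sqrt 2 + \<epsilon>) * opt_max_match (eucl_dist d) P} \<ge> 2 / 3"
proof -
  let ?M = "gaussian_JL t d"
  let ?o = "opt_max_match (eucl_dist d) P"
  let ?O = "\<lambda>G. opt_max_match (eucl_dist t) (apply_matrix t d G ` P)"
  have "0 < 288 / \<epsilon>\<^sup>2" using \<epsilon> by simp
  then have t0: "0 < t" using t by (cases t) auto
  interpret prob_space ?M using t0 by (rule prob_space_gaussian_JL)
  define r where "r = sqrt (2 / real t)"
  have r: "0 \<le> r" "r \<le> \<epsilon> / 12"
  proof -
    have "288 \<le> real t * \<epsilon>\<^sup>2" using t \<epsilon> by (simp add: pos_divide_le_eq)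
    then have "2 / real t \<le> (\<epsilon> / 12)\<^sup>2" using t0 by (simp add: pos_divide_le_eq power_divide mult.commute)
    then show "r \<le> \<epsilon> / 12" unfolding r_def using \<epsilon> by (intro real_le_lsqrt) auto
  qed (simp add: r_def)
  let ?D = "\<lambda>G p q. \<bar>eucl_dist t (apply_matrix t d G p) (apply_matrix t d G q) - eucl_dist d p q\<bar>"
  have D: "integrable ?M (\<lambda>G. ?D G p q)" "expectation (\<lambda>G. ?D G p q) \<le> r * eucl_dist d p q" for p q
    using gaussian_JL_norm_deviation[OF t0, of d "\<lambda>j. p j - q j"]
    unfolding eucl_dist_apply_matrix r_def eucl_dist_def[of d] by auto
  have ext: "apply_matrix t d G p \<in> {..<t} \<rightarrow>\<^sub>E UNIV" for G p unfolding apply_matrix_def by simp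
  have meas [measurable]: "?O \<in> borel_measurable ?M"
  proof (rule borel_measurable_opt_max_match_image[OF P(1)])
    show "(\<lambda>G. eucl_dist t (apply_matrix t d G p) (apply_matrix t d G q)) \<in> borel_measurable ?M" for p q
      unfolding eucl_dist_apply_matrix eucl_norm_def gaussian_JL_def by measurable
  qed (rule eucl_dist_eq_0_iff[OF ext ext])
  obtain z where z: "(\<Sum>p\<in>P. eucl_dist d p z) \<le> sqrt 2 * ?o"
    by (rule star_le_sqrt2_opt[OF P(1,3)])
  obtain N where N: "is_matching P N" "?o = (\<Sum>(p,q)\<in>N. eucl_dist d p q)"
    by (rule opt_max_match_attained[OF P(1)])
  let ?U = "\<lambda>G. \<Sum>p\<in>P. ?D G p z" and ?L = "\<lambda>G. \<Sum>(p,q)\<in>N. ?D G p q"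
  have U: "integrable ?M ?U" "expectation ?U \<le> r * (sqrt 2 * ?o)"
  proof -
    show "integrable ?M ?U" using D(1) by simp
    have "expectation ?U = (\<Sum>p\<in>P. expectation (\<lambda>G. ?D G p z))" using D(1) by (rule Bochner_Integration.integral_sum)
    also have "\<dots> \<le> (\<Sum>p\<in>P. r * eucl_dist d p z)" by (intro sum_mono D)
    also have "\<dots> \<le> r * (sqrt 2 * ?o)" unfolding sum_distrib_left[symmetric] using z r by (intro mult_left_mono)
    finally show "expectation ?U \<le> r * (sqrt 2 * ?o)" .
  qed
  have L: "integrable ?M ?L" "expectation ?L \<le> r * ?o"
  proof -
    show "integrable ?M ?L" unfolding case_prod_unfold using D(1) by simp
    have "expectation ?L = (\<Sum>x\<in>N. expectation (\<lambda>G. ?D G (fst x) (snd x)))"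
      unfolding case_prod_unfold using D(1) by (rule Bochner_Integration.integral_sum)
    also have "\<dots> \<le> (\<Sum>x\<in>N. r * eucl_dist d (fst x) (snd x))" by (intro sum_mono D)
    also have "\<dots> = r * ?o" unfolding N(2) by (simp add: sum_distrib_left case_prod_unfold)
    finally show "expectation ?L \<le> r * ?o" .
  qed
  \<comment> \<open>\<open>V G < 1\<close> bounds the deviation of the star by
    \<open>\<epsilon> * ?o\<close> and that of the optimal matching by half as much. The half is
    what the lower bound needs, as \<open>1 - \<epsilon> / 2\<close> is at least
    \<open>1 / (1 + \<epsilon>)\<close> for \<open>\<epsilon>\<close> in the unit interval.\<close>
  define V where "V = (\<lambda>G. (?U G + 2 * ?L G) / (\<epsilon> * ?o))"
  have U0: "0 \<le> ?U G" and L0: "0 \<le> ?L G" for G by (auto intro!: sum_nonneg)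
  have eo: "0 < \<epsilon> * ?o" using \<epsilon> opt by simp
  have V: "integrable ?M V" unfolding V_def using U L by simp
  have "expectation V = (expectation ?U + 2 * expectation ?L) / (\<epsilon> * ?o)"
    unfolding V_def using U L by simp
  also have "\<dots> \<le> (r * (sqrt 2 * ?o) + 2 * (r * ?o)) / (\<epsilon> * ?o)"
    using U L eo by (intro divide_right_mono add_mono mult_left_mono) auto
  also have "\<dots> = r * (sqrt 2 + 2) / \<epsilon>" using opt \<epsilon> by (simp add: field_simps)
  also have "\<dots> \<le> (\<epsilon> / 12) * 4 / \<epsilon>"
    using r \<epsilon> real_le_lsqrt[of 2 2] by (intro divide_right_mono mult_mono) auto
  also have "\<dots> = 1 / 3" using \<epsilon> by simp
  finally have EV: "expectation V \<le> 1 / 3" .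
  have mV [measurable]: "V \<in> borel_measurable ?M" using V by (rule borel_measurable_integrable)
  text \<open>A single application of Markov's inequality covers both bounds; \<open>\<surd>(2 / 288) = 1 / 12\<close> makes the
    failure probability at most \<open>(\<surd>2 + 2) / 12 \<le> 1 / 3\<close>.\<close>
  have "prob {G \<in> space ?M. 1 \<le> V G} \<le> expectation V / 1"
    by (rule integral_Markov_inequality_measure[OF V sets.top]) (use U0 L0 eo in \<open>auto simp: V_def intro!: AE_I2 divide_nonneg_pos add_nonneg_nonneg\<close>)
  then have "prob {G \<in> space ?M. 1 \<le> V G} \<le> 1 / 3" using EV by simp
  moreover have "prob {G \<in> space ?M. \<not> 1 \<le> V G} = 1 - prob {G \<in> space ?M. 1 \<le> V G}"
    by (rule prob_neg) measurable
  ultimately have good: "2 / 3 \<le> prob {G \<in> space ?M. \<not> 1 \<le> V G}" by linarith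
  \<comment> \<open>The inclusion of events holds only off the null set of matrices that identify
    two points of \<open>P\<close>; the lower bound needs injectivity.\<close>
  have "AE G in ?M. inj_on (apply_matrix t d G) P"
    using P(2) by (intro AE_inj_on_finite P(1) AE_apply_matrix_neq t0) (auto simp: eucl_dist_eq_0_iff subset_iff)
  then have ae: "AE G in ?M. G \<in> {G \<in> space ?M. \<not> 1 \<le> V G} \<longrightarrow>
      G \<in> {G \<in> space ?M. ?o / (1 + \<epsilon>) \<le> ?O G \<and> ?O G \<le> (sqrt 2 + \<epsilon>) * ?o}"
  proof eventually_elim
    case (elim G)
    show ?case
    proof (rule impI)
      assume a: "G \<in> {G \<in> space ?M. \<not> 1 \<le> V G}"
      then have "V G < 1" by simp
      then have s: "?U G + 2 * ?L G < \<epsilon> * ?o" unfolding V_def using eo by (simp add: pos_divide_less_eq)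
      have "?O G \<le> (\<Sum>p\<in>P. eucl_dist t (apply_matrix t d G p) (apply_matrix t d G z))"
        by (rule opt_max_match_image_le_star[OF P(1), where h="\<lambda>x. eucl_dist t x (apply_matrix t d G z)"])
          (auto intro: eucl_dist_triangle)
      also have "\<dots> \<le> (\<Sum>p\<in>P. ?D G p z + eucl_dist d p z)" by (intro sum_mono) auto
      also have "\<dots> = ?U G + (\<Sum>p\<in>P. eucl_dist d p z)" by (rule sum.distrib)
      also have "\<dots> \<le> \<epsilon> * ?o + sqrt 2 * ?o" using s L0[of G] z by linarith
      finally have upper: "?O G \<le> (sqrt 2 + \<epsilon>) * ?o" by (simp add: algebra_simps)
      have "?o - ?L G = (\<Sum>x\<in>N. eucl_dist d (fst x) (snd x) - ?D G (fst x) (snd x))"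
        unfolding N(2) by (simp add: sum_subtractf case_prod_unfold)
      also have "\<dots> \<le> (\<Sum>x\<in>N. eucl_dist t (apply_matrix t d G (fst x)) (apply_matrix t d G (snd x)))"
        by (intro sum_mono) auto
      also have "\<dots> \<le> ?O G"
        using opt_max_match_image_ge[OF P(1) N(1) elim, of "eucl_dist t"] by (simp add: case_prod_unfold)
      finally have "?o - ?L G \<le> ?O G" .
      then have lower: "?o - \<epsilon> / 2 * ?o \<le> ?O G" using s U0[of G] by linarith
      have "1 \<le> (1 - \<epsilon> / 2) * (1 + \<epsilon>)" using \<epsilon> by (simp add: algebra_simps)
      then have "1 / (1 + \<epsilon>) \<le> 1 - \<epsilon> / 2" using \<epsilon> by (simp add: pos_divide_le_eq)
      then have "?o * (1 / (1 + \<epsilon>)) \<le> ?o * (1 - \<epsilon> / 2)" using opt by (intro mult_left_mono) auto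
      then have "?o / (1 + \<epsilon>) \<le> ?o - \<epsilon> / 2 * ?o" by (simp add: algebra_simps)
      then show "G \<in> {G \<in> space ?M. ?o / (1 + \<epsilon>) \<le> ?O G \<and> ?O G \<le> (sqrt 2 + \<epsilon>) * ?o}"
        using a lower upper by auto
    qed
  qed
  have "prob {G \<in> space ?M. \<not> 1 \<le> V G} \<le> prob {G \<in> space ?M. ?o / (1 + \<epsilon>) \<le> ?O G \<and> ?O G \<le> (sqrt 2 + \<epsilon>) * ?o}"
    by (rule finite_measure_mono_AE[OF ae]) measurable
  with good show ?thesis by linarith
qed

theorem mainTheorem6:
  shows "(\<forall>d::nat. \<forall>P. finite P \<and> P \<subseteq> ({..<d} \<rightarrow>\<^sub>E (UNIV::real set)) \<and> even (card P)
            \<and> opt_max_match (eucl_dist d) P > 0 \<longrightarrow>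
          (let E = (\<integral>\<gamma>. opt_max_match (\<lambda>a b. \<bar>a - b\<bar>) (lin_form d \<gamma> ` P) \<partial>gamma_space d)
           in 1 \<le> E / opt_max_match (eucl_dist d) P \<and> E / opt_max_match (eucl_dist d) P \<le> sqrt 2))
   \<and> (\<exists>C::real. C > 0 \<and>
        (\<forall>\<epsilon>::real. 0 < \<epsilon> \<and> \<epsilon> < 1 \<longrightarrow>
          (\<forall>d::nat. \<forall>P. finite P \<and> P \<subseteq> ({..<d} \<rightarrow>\<^sub>E (UNIV::real set)) \<and> even (card P)
              \<and> opt_max_match (eucl_dist d) P > 0 \<longrightarrow>
            (let t = nat \<lceil>C / \<epsilon>\<^sup>2\<rceil> in
             measure (gaussian_JL t d)
               {G \<in> space (gaussian_JL t d).
                  opt_max_match (eucl_dist d) P / (1 + \<epsilon>)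
                    \<le> opt_max_match (eucl_dist t) (apply_matrix t d G ` P)
                  \<and> opt_max_match (eucl_dist t) (apply_matrix t d G ` P)
                    \<le> (sqrt 2 + \<epsilon>) * opt_max_match (eucl_dist d) P} \<ge> 2 / 3))))"
proof (intro conjI allI impI exI[of _ 288])
  fix d and P :: "(nat \<Rightarrow> real) set"
  assume P: "finite P \<and> P \<subseteq> {..<d} \<rightarrow>\<^sub>E UNIV \<and> even (card P) \<and> 0 < opt_max_match (eucl_dist d) P"
  show "let E = \<integral>\<gamma>. opt_max_match (\<lambda>a b. \<bar>a - b\<bar>) (lin_form d \<gamma> ` P) \<partial>gamma_space d
        in 1 \<le> E / opt_max_match (eucl_dist d) P \<and> E / opt_max_match (eucl_dist d) P \<le> sqrt 2"
    using expected_opt_lin_form[of P d] P by (simp add: Let_def pos_le_divide_eq pos_divide_le_eq)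
next
  fix \<epsilon> :: real and d and P :: "(nat \<Rightarrow> real) set"
  assume e: "0 < \<epsilon> \<and> \<epsilon> < 1"
    and P: "finite P \<and> P \<subseteq> {..<d} \<rightarrow>\<^sub>E UNIV \<and> even (card P) \<and> 0 < opt_max_match (eucl_dist d) P"
  have "288 / \<epsilon>\<^sup>2 \<le> real (nat \<lceil>288 / \<epsilon>\<^sup>2\<rceil>)" by (rule real_nat_ceiling_ge)
  then show "let t = nat \<lceil>288 / \<epsilon>\<^sup>2\<rceil> in
             measure (gaussian_JL t d)
               {G \<in> space (gaussian_JL t d).
                  opt_max_match (eucl_dist d) P / (1 + \<epsilon>)
                    \<le> opt_max_match (eucl_dist t) (apply_matrix t d G ` P)
                  \<and> opt_max_match (eucl_dist t) (apply_matrix t d G ` P)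
                    \<le> (sqrt 2 + \<epsilon>) * opt_max_match (eucl_dist d) P} \<ge> 2 / 3"
    unfolding Let_def using e P by (intro gaussian_JL_opt_approximation) auto
qed simp

end
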